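(* For $j=1,\ldots,N$ and all $s$ with $\mathrm{Re}(s)\ge0$, $s\notin\{\nu_1,\ldots,\nu_N\}$, $$Z_j(s)=\Big(pc_j^*(s)+q\frac{\nu_j}{\nu_j-s}\Big)\sum_{i=1}^Np_{i,j}\beta_i^*(se^{-rt})Z_i(se^{-rt})-\frac{sq}{\nu_j-s}\sum_{i=1}^Np_{i,j}\beta_i^*(\nu_je^{-rt})Z_i(\nu_je^{-rt}).$$ Moreover, with $\mathcal H(s):=\tilde C(s)P^TB^*(se^{-rt})$ and $\tilde Q(s):=q(I-\widehat L(s))\tilde r$, for all $s$ with $\mathrm{Re}(s)\ge0$ such that $e^{-rtn}s\notin\{\nu_1,\ldots,\nu_N\}$ for all $n\ge0$, $$\tilde Z(s)=\sum_{n=0}^\infty\prod_{d=0}^{n-1}\mathcal H(e^{-rtd}s)\,\tilde Q(e^{-rtn}s)+\prod_{n=0}^\infty\mathcal H(e^{-rtn}s)\,\tilde\pi .$$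
   Context: Modulated $D/G/1$ shot-noise queue. Let $E=\{1,\ldots,N\}$, $r>0$, $t>0$, $p\in[0,1]$, $q=1-p$. $(Y_n)_{n\ge0}$ is an irreducible discrete-time Markov chain on $E$ with transition matrix $P=(p_{i,j})$ and stationary distribution $\tilde\pi=(\pi_1,\ldots,\pi_N)^T$. Interarrival times are all equal to $t$, and the workload $W_n\ge0$ before the $n$th arrival satisfies $W_{n+1}=[e^{-rt}(W_n+S_n)+C_{n+1}]^+$, $[x]^+=\max(0,x)$. Given $Y_n$, the triple $(C_{n+1},S_n,Y_{n+1})$ is independent of the past (in particular of $W_n$), and $$P(C_{n+1}\le x,S_n\le y,Y_{n+1}=j\mid Y_n=i)=p_{i,j}F_{S,i}(y)G_{C,j}(x),$$ where $F_{S,i}$ is a distribution function on $[0,\infty)$ and $G_{C,j}$ is the law of a random variable equal to $C^+$ with probability $p$ and to $-C^-$ with probability $q$, where (for state $j$) $C^+\ge0$ has Laplace–Stieltjes transform (LST) $c_j^*(s)$ and $C^-$ is exponential with rate $\nu_j>0$. Notation: $\beta_i^*(s)=\int_0^\infty e^{-sy}dF_{S,i}(y)$, $B^*(s)=\mathrm{diag}(\beta_1^*(s),\ldots,\beta_N^*(s))$, $\widehat L(s)=\mathrm{diag}\big(\frac{\nu_1}{\nu_1-s},\ldots,\frac{\nu_N}{\nu_N-s}\big)$, $\tilde C(s)=p\,\mathrm{diag}(c_1^*(s),\ldots,c_N^*(s))+q\widehat L(s)$, $\tilde r=(r_1,\ldots,r_N)^T$ with $r_j=\sum_{i=1}^Np_{i,j}\beta_i^*(\nu_je^{-rt})Z_i(\nu_je^{-rt})$.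 For $\mathrm{Re}(s)\ge0$, $Z_i(s)=\lim_{n\to\infty}E(e^{-sW_n}1_{\{Y_n=i\}})$; it is assumed that these limits exist and are the transforms $E(e^{-sW}1_{\{Y=i\}})$ of a steady-state pair $(W,Y)$ with $W$ finite and $P(Y=i)=\pi_i$. $\tilde Z(s)=(Z_1(s),\ldots,Z_N(s))^T$. Matrix products are ordered with increasing index from left to right, empty products are the identity, and $\prod_{n=0}^\infty \mathcal H(e^{-rtn}s)\tilde\pi$ means $\lim_{n\to\infty}\prod_{m=0}^{n}\mathcal H(e^{-rtm}s)\tilde\pi$. *)

theory Defs
  imports "HOL-Probability.Probability"
begin

section \<open>Markov chains on a finite state space\<close>

text \<open>The state space \<open>E = {1, \<dots>, N}\<close> is rendered by a finite type \<open>'n\<close> with \<open>CARD('n) = N\<close>.\<close>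

definition stochastic_matrix :: "real^'n^'n \<Rightarrow> bool" where
  "stochastic_matrix P \<longleftrightarrow> (\<forall>i j. 0 \<le> P $ i $ j) \<and> (\<forall>i. (\<Sum>j\<in>UNIV. P $ i $ j) = 1)"

text \<open>The product on \<open>real^'n^'n\<close> is \<open>**\<close>, so that the \<open>m\<close>-step transition matrix is an
  iterate of \<open>(**) P\<close> (the operator \<open>^\<close> is not the matrix power).\<close>

definition irreducible_matrix :: "real^'n^'n \<Rightarrow> bool" where
  "irreducible_matrix P \<longleftrightarrow> (\<forall>i j. \<exists>m::nat. (((**) P) ^^ m) (mat 1) $ i $ j > 0)"

definition stationary_distribution :: "real^'n^'n \<Rightarrow> real^'n \<Rightarrow> bool" where
  "stationary_distribution P \<pi> \<longleftrightarrow>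
     (\<forall>i. 0 \<le> \<pi> $ i) \<and> (\<Sum>i\<in>UNIV. \<pi> $ i) = 1 \<and> \<pi> v* P = \<pi>"

definition markov_chain :: "'a measure \<Rightarrow> real^'n^'n \<Rightarrow> (nat \<Rightarrow> 'a \<Rightarrow> 'n) \<Rightarrow> bool" where
  "markov_chain M P Y \<longleftrightarrow>
     stochastic_matrix P \<and>
     (\<forall>n. Y n \<in> M \<rightarrow>\<^sub>M count_space UNIV) \<and>
     (\<forall>n y j. \<P>(\<omega> in M. \<forall>k\<le>n. Y k \<omega> = y k) > 0 \<longrightarrow>
        \<P>(\<omega> in M. Y (Suc n) \<omega> = j \<bar> \<forall>k\<le>n. Y k \<omega> = y k) = P $ y n $ j)"


section \<open>The modulated D/G/1 shot-noise queue\<close>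

definition nonneg_law :: "real measure \<Rightarrow> bool" where
  "nonneg_law \<mu> \<longleftrightarrow> real_distribution \<mu> \<and> measure \<mu> {..<0} = 0"

text \<open>Distribution function of a random variable equal to \<open>C\<^sup>+\<close> (of law \<open>\<mu>\<close>) with
  probability \<open>p\<close> and to \<open>- C\<^sup>-\<close> with probability \<open>1 - p\<close>, where \<open>C\<^sup>-\<close> is exponential
  with rate \<open>\<nu>\<close>.\<close>

definition jump_cdf :: "real \<Rightarrow> real measure \<Rightarrow> real \<Rightarrow> real \<Rightarrow> real" where
  "jump_cdf p \<mu> \<nu> x =
     p * cdf \<mu> x + (1 - p) * cdf (distr (density lborel (exponential_density \<nu>)) borel uminus) x"

text \<open>The past at time \<open>n\<close>: the \<open>\<sigma>\<close>-algebra generated by \<open>W\<^sub>k, Y\<^sub>k\<close> for \<open>k \<le> n\<close> and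
  \<open>S\<^sub>k, C\<^sub>k\<^sub>+\<^sub>1\<close> for \<open>k < n\<close>.\<close>

definition past ::
  "'a measure \<Rightarrow> (nat \<Rightarrow> 'a \<Rightarrow> 'n) \<Rightarrow> (nat \<Rightarrow> 'a \<Rightarrow> real) \<Rightarrow> (nat \<Rightarrow> 'a \<Rightarrow> real) \<Rightarrow>
   (nat \<Rightarrow> 'a \<Rightarrow> real) \<Rightarrow> nat \<Rightarrow> 'a set set" where
  "past M Y W S C n = sigma_sets (space M)
     ((\<Union>k\<in>{..n}. sets (vimage_algebra (space M) (W k) borel)
                \<union> sets (vimage_algebra (space M) (Y k) (count_space UNIV)))
    \<union> (\<Union>k\<in>{..<n}. sets (vimage_algebra (space M) (S k) borel)
                \<union> sets (vimage_algebra (space M) (C (Suc k)) borel)))"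

definition innovation ::
  "'a measure \<Rightarrow> (nat \<Rightarrow> 'a \<Rightarrow> 'n) \<Rightarrow> (nat \<Rightarrow> 'a \<Rightarrow> real) \<Rightarrow> (nat \<Rightarrow> 'a \<Rightarrow> real) \<Rightarrow>
   nat \<Rightarrow> 'a set set" where
  "innovation M Y S C n = sets (vimage_algebra (space M)
     (\<lambda>\<omega>. (C (Suc n) \<omega>, S n \<omega>, Y (Suc n) \<omega>)) (borel \<Otimes>\<^sub>M borel \<Otimes>\<^sub>M count_space UNIV))"

text \<open>\<open>FS i\<close> is the law with distribution function \<open>F\<^sub>S\<^sub>,\<^sub>i\<close>, and \<open>Cp j\<close> the law of \<open>C\<^sup>+\<close> in
  state \<open>j\<close>. Conditioning on \<open>Y\<^sub>n = i\<close> is only meaningful if this event has positive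
  probability. The variable \<open>C 0\<close> plays no role.\<close>

locale modulated_shot_noise_queue = prob_space M
  for M :: "'a measure" +
  fixes r t p :: real
    and P :: "real^'n^'n" and \<pi> :: "real^'n"
    and FS Cp :: "'n \<Rightarrow> real measure" and \<nu> :: "'n \<Rightarrow> real"
    and Y :: "nat \<Rightarrow> 'a \<Rightarrow> 'n" and W S C :: "nat \<Rightarrow> 'a \<Rightarrow> real"
  assumes r_pos: "r > 0" and t_pos: "t > 0" and p_range: "0 \<le> p" "p \<le> 1"
    and nu_pos: "\<And>j. \<nu> j > 0"
    and FS_law: "\<And>i. nonneg_law (FS i)"
    and Cp_law: "\<And>j. nonneg_law (Cp j)"
    and Y_chain: "markov_chain M P Y"
    and P_irreducible: "irreducible_matrix P"
    and pi_stationary: "stationary_distribution P \<pi>"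
    and W_rv: "\<And>n. W n \<in> borel_measurable M"
    and S_rv: "\<And>n. S n \<in> borel_measurable M"
    and C_rv: "\<And>n. C n \<in> borel_measurable M"
    and W_nonneg: "\<And>n \<omega>. \<omega> \<in> space M \<Longrightarrow> W n \<omega> \<ge> 0"
    and W_recursion: "\<And>n \<omega>. \<omega> \<in> space M \<Longrightarrow>
      W (Suc n) \<omega> = max 0 (exp (- r * t) * (W n \<omega> + S n \<omega>) + C (Suc n) \<omega>)"
    and innovation_law: "\<And>n i j x y. \<P>(\<omega> in M. Y n \<omega> = i) > 0 \<Longrightarrow>
      \<P>(\<omega> in M. C (Suc n) \<omega> \<le> x \<and> S n \<omega> \<le> y \<and> Y (Suc n) \<omega> = j \<bar> Y n \<omega> = i)
        = P $ i $ j * cdf (FS i) y * jump_cdf p (Cp j) (\<nu> j) x"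
    and innovation_indep: "\<And>n i. \<P>(\<omega> in M. Y n \<omega> = i) > 0 \<Longrightarrow>
      prob_space.indep_set (uniform_measure M {\<omega> \<in> space M. Y n \<omega> = i})
        (innovation M Y S C n) (past M Y W S C n)"


section \<open>Transforms and matrices\<close>

definition lst :: "real measure \<Rightarrow> complex \<Rightarrow> complex" where
  "lst \<mu> s = (LINT x:{0..}|\<mu>. exp (- s * complex_of_real x))"

text \<open>The transform \<open>E (e\<^bsup>-sX\<^esup> 1\<^bsub>{Y=i}\<^esub>)\<close>.\<close>

definition joint_transform ::
  "'a measure \<Rightarrow> ('a \<Rightarrow> real) \<Rightarrow> ('a \<Rightarrow> 'n) \<Rightarrow> 'n \<Rightarrow> complex \<Rightarrow> complex" where
  "joint_transform M X Y i s =
     (LINT \<omega>|M. exp (- s * complex_of_real (X \<omega>)) * indicator {\<omega>. Y \<omega> = i} \<omega>)"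

text \<open>\<open>Z i\<close> is the limit of the transforms of \<open>(W\<^sub>n, Y\<^sub>n)\<close>, and the transform of the
  steady-state pair \<open>(Winf, Yinf)\<close>, which lives on its own probability space and is
  real-valued, hence finite.\<close>

definition steady_state ::
  "'a measure \<Rightarrow> (nat \<Rightarrow> 'a \<Rightarrow> 'n) \<Rightarrow> (nat \<Rightarrow> 'a \<Rightarrow> real) \<Rightarrow> real^'n \<Rightarrow>
   'b measure \<Rightarrow> ('b \<Rightarrow> real) \<Rightarrow> ('b \<Rightarrow> 'n) \<Rightarrow> ('n \<Rightarrow> complex \<Rightarrow> complex) \<Rightarrow> bool" where
  "steady_state M Y W \<pi> M' Winf Yinf Z \<longleftrightarrow>
     prob_space M' \<and> Winf \<in> borel_measurable M' \<and> Yinf \<in> M' \<rightarrow>\<^sub>M count_space UNIV \<and>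
     (AE \<omega> in M'. Winf \<omega> \<ge> 0) \<and>
     (\<forall>i. \<P>(\<omega> in M'. Yinf \<omega> = i) = \<pi> $ i) \<and>
     (\<forall>i s. Re s \<ge> 0 \<longrightarrow>
        (\<lambda>n. joint_transform M (W n) (Y n) i s) \<longlonglongrightarrow> Z i s \<and>
        Z i s = joint_transform M' Winf Yinf i s)"

definition diag_matrix :: "('n \<Rightarrow> complex) \<Rightarrow> complex^'n^'n" where
  "diag_matrix d = (\<chi> i j. if i = j then d i else 0)"

definition of_real_matrix :: "real^'n^'m \<Rightarrow> complex^'n^'m" where
  "of_real_matrix A = (\<chi> i j. complex_of_real (A $ i $ j))"

definition of_real_vec :: "real^'n \<Rightarrow> complex^'n" where
  "of_real_vec v = (\<chi> i. complex_of_real (v $ i))"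

text \<open>\<open>A 0 ** A 1 ** \<dots> ** A (n - 1)\<close>\<close>

primrec matrix_prod :: "(nat \<Rightarrow> complex^'n^'n) \<Rightarrow> nat \<Rightarrow> complex^'n^'n" where
  "matrix_prod A 0 = mat 1"
| "matrix_prod A (Suc n) = matrix_prod A n ** A n"

definition B_mat :: "('n \<Rightarrow> real measure) \<Rightarrow> complex \<Rightarrow> complex^'n^'n" where
  "B_mat FS s = diag_matrix (\<lambda>i. lst (FS i) s)"

definition L_mat :: "('n \<Rightarrow> real) \<Rightarrow> complex \<Rightarrow> complex^'n^'n" where
  "L_mat \<nu> s = diag_matrix (\<lambda>j. of_real (\<nu> j) / (of_real (\<nu> j) - s))"

definition C_mat ::
  "real \<Rightarrow> ('n \<Rightarrow> real measure) \<Rightarrow> ('n \<Rightarrow> real) \<Rightarrow> complex \<Rightarrow> complex^'n^'n" where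
  "C_mat p Cp \<nu> s = p *\<^sub>R diag_matrix (\<lambda>j. lst (Cp j) s) + (1 - p) *\<^sub>R L_mat \<nu> s"

definition H_mat ::
  "real \<Rightarrow> real \<Rightarrow> real \<Rightarrow> real^'n^'n \<Rightarrow> ('n \<Rightarrow> real measure) \<Rightarrow> ('n \<Rightarrow> real measure) \<Rightarrow>
   ('n \<Rightarrow> real) \<Rightarrow> complex \<Rightarrow> complex^'n^'n" where
  "H_mat r t p P FS Cp \<nu> s =
     C_mat p Cp \<nu> s ** transpose (of_real_matrix P) ** B_mat FS (s * of_real (exp (- r * t)))"

definition r_vec ::
  "real \<Rightarrow> real \<Rightarrow> real^'n^'n \<Rightarrow> ('n \<Rightarrow> real measure) \<Rightarrow> ('n \<Rightarrow> real) \<Rightarrow>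
   ('n \<Rightarrow> complex \<Rightarrow> complex) \<Rightarrow> complex^'n" where
  "r_vec r t P FS \<nu> Z = (\<chi> j. \<Sum>i\<in>UNIV.
     of_real (P $ i $ j) * lst (FS i) (of_real (\<nu> j * exp (- r * t)))
       * Z i (of_real (\<nu> j * exp (- r * t))))"

definition Q_vec ::
  "real \<Rightarrow> real \<Rightarrow> real \<Rightarrow> real^'n^'n \<Rightarrow> ('n \<Rightarrow> real measure) \<Rightarrow> ('n \<Rightarrow> real) \<Rightarrow>
   ('n \<Rightarrow> complex \<Rightarrow> complex) \<Rightarrow> complex \<Rightarrow> complex^'n" where
  "Q_vec r t p P FS \<nu> Z s = (1 - p) *\<^sub>R ((mat 1 - L_mat \<nu> s) *v r_vec r t P FS \<nu> Z)"

end

theory Submission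
  imports Defs
begin

text \<open>The functional equation is a one-step computation. On \<open>{Y\<^sub>n = i, Y\<^sub>n\<^sub>+\<^sub>1 = j}\<close> the workload
  \<open>W\<^sub>n\<close>, the service \<open>S\<^sub>n\<close> and the jump \<open>C\<^sub>n\<^sub>+\<^sub>1\<close> are independent up to the factor \<open>p\<^sub>i\<^sub>,\<^sub>j\<close>
  (\<open>joint_law\<close>), so \<open>E (e\<^bsup>-sW\<^esup> 1)\<close> at time \<open>n + 1\<close> is an iterated integral that can be computed from
  the inside. For a level \<open>z \<ge> 0\<close> before the jump, a positive jump never meets the barrier \<open>0\<close> and
  contributes the factor \<open>c\<^sub>j(s)\<close>. Since its density is exponential, a negative jump contributes
  \<open>\<nu> / (\<nu> - s) e\<^bsup>-sz\<^esup> - s / (\<nu> - s) e\<^bsup>-\<nu>z\<^esup>\<close>, which is again a combination of exponentials in \<open>z\<close>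
  (\<open>transform_reflected_neg_exponential\<close>). With \<open>z = e\<^bsup>-rt\<^esup>(W\<^sub>n + S\<^sub>n)\<close> both exponentials factor into
  transforms of \<open>S\<^sub>n\<close> and \<open>W\<^sub>n\<close>, at \<open>s e\<^bsup>-rt\<^esup>\<close> and at \<open>\<nu> e\<^bsup>-rt\<^esup>\<close>. This gives a recursion in \<open>n\<close>
  (\<open>joint_transform_step\<close>) in which \<open>n\<close> tends to infinity.

  In vector form the equation is \<open>Z(s) = H(s) Z(e\<^bsup>-rt\<^esup> s) + Q(s)\<close>, to be iterated along
  \<open>s\<^sub>n = e\<^bsup>-rtn\<^esup> s\<close>. No moment of the service times or of the positive jumps is assumed, so
  \<open>H(s\<^sub>n)\<close> may approach \<open>P\<^sup>T\<close> arbitrarily slowly, and convergence of the infinite product cannot come from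
  summability of \<open>H(s\<^sub>n) - P\<^sup>T\<close>. Two weaker facts suffice. First, the operator norm of
  \<open>H(s\<^sub>n)\<close> for the \<open>\<ell>\<^sup>1\<close>-norm is at most \<open>1 + O(e\<^bsup>-rtn\<^esup>)\<close>: Laplace transforms have modulus
  at most \<open>1\<close>, \<open>P\<^sup>T\<close> is a contraction, and \<open>\<nu> / (\<nu> - s\<^sub>n) = 1 + s\<^sub>n / (\<nu> - s\<^sub>n)\<close>
  (\<open>l1norm_H_mat_le\<close>). Hence all partial products are uniformly bounded, and the series converges because
  \<open>Q(s\<^sub>n) = O(e\<^bsup>-rtn\<^esup>)\<close>. Secondly, \<open>Z(s\<^sub>n)\<close> tends to \<open>Z(0) = \<pi>\<close> since the steady-state workload is
  finite. So replacing \<open>Z(s\<^sub>n)\<close> by \<open>\<pi>\<close> in the remainder of the iteration changes it by a null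
  sequence, and convergence of the series forces that of the product (\<open>linear_recursion_solution\<close>).\<close>

section \<open>Laws on the real line\<close>

text \<open>Lower orthants form an intersection-stable generator of the Borel sets, which lets a joint law be
  identified from distribution functions in several variables at once.\<close>

lemma finite_borel_measure_eqI_atMost:
  fixes \<mu> \<kappa> :: "'c::ordered_euclidean_space measure"
  assumes fin: "finite_measure \<mu>" and sets: "sets \<mu> = sets borel" "sets \<kappa> = sets borel"
    and eq: "\<And>x. emeasure \<mu> {..x} = emeasure \<kappa> {..x}"
  shows "\<mu> = \<kappa>"
proof (rule measure_eqI_generator_eq[where E="range (\<lambda>a::'c. {..a})" and \<Omega>=UNIV and A="\<lambda>n. {..real n *\<^sub>R One}"])
  show "Int_stable (range (\<lambda>a::'c. {..a}))"
  proof -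
    have "{..a} \<inter> {..b} = {..inf a b}" for a b :: 'c by auto
    then show ?thesis by (auto simp: Int_stable_def)
  qed
  have "sets (borel::'c measure) = sigma_sets UNIV (range (\<lambda>a::'c. {..a}))"
    by (simp add: borel_eq_atMost)
  then show "sets \<mu> = sigma_sets UNIV (range (\<lambda>a::'c. {..a}))" "sets \<kappa> = sigma_sets UNIV (range (\<lambda>a::'c. {..a}))"
    using sets by auto
  show "(\<Union>n. {..real n *\<^sub>R (One::'c)}) = UNIV"
  proof -
    have "\<exists>n. x \<le> real n *\<^sub>R (One::'c)" for x :: 'c
    proof -
      obtain n where "norm x \<le> real n" using real_arch_simple by blast
      then show ?thesis
        by (intro exI[of _ n]) (auto simp: eucl_le[where 'a='c] intro: order_trans[OF order_trans[OF abs_ge_self Basis_le_norm]])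
    qed
    then show ?thesis by auto
  qed
  show "emeasure \<mu> {..real n *\<^sub>R One} \<noteq> \<infinity>" for n
    using finite_measure.emeasure_finite[OF fin] by auto
qed (use eq in auto)

text \<open>The mixture is realized as the law of a single random variable: a coin with success
  probability \<open>p\<close> selects one of two independent draws. In this form it is a probability measure by
  construction.\<close>

definition mixture_law :: "real \<Rightarrow> real measure \<Rightarrow> real measure \<Rightarrow> real measure" where
  "mixture_law p \<mu> \<kappa> =
     distr (measure_pmf (bernoulli_pmf p) \<Otimes>\<^sub>M (\<mu> \<Otimes>\<^sub>M \<kappa>)) borel (\<lambda>(b, x, y). if b then x else y)"

lemma mixture_law_measurable:
  assumes "real_distribution \<mu>" "real_distribution \<kappa>"
  shows "(\<lambda>(b, x, y). if b then x else y)
     \<in> measure_pmf (bernoulli_pmf p) \<Otimes>\<^sub>M (\<mu> \<Otimes>\<^sub>M \<kappa>) \<rightarrow>\<^sub>M (borel :: real measure)"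
proof -
  interpret \<mu>: real_distribution \<mu> by fact
  interpret \<kappa>: real_distribution \<kappa> by fact
  have [measurable_cong]: "sets \<mu> = sets borel" "sets \<kappa> = sets borel" by auto
  show ?thesis unfolding split_beta by measurable
qed

lemma real_distribution_mixture_law:
  assumes "real_distribution \<mu>" "real_distribution \<kappa>"
  shows "real_distribution (mixture_law p \<mu> \<kappa>)"
proof -
  interpret \<mu>: real_distribution \<mu> by fact
  interpret \<kappa>: real_distribution \<kappa> by fact
  interpret \<mu>\<kappa>: pair_prob_space \<mu> \<kappa> ..
  interpret b\<mu>\<kappa>: pair_prob_space "measure_pmf (bernoulli_pmf p)" "\<mu> \<Otimes>\<^sub>M \<kappa>" ..
  show ?thesis unfolding mixture_law_def
    by (intro b\<mu>\<kappa>.real_distribution_distr mixture_law_measurable assms)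
qed

lemma integral_mixture_law:
  fixes f :: "real \<Rightarrow> 'c::{banach, second_countable_topology}"
  assumes \<mu>: "real_distribution \<mu>" and \<kappa>: "real_distribution \<kappa>" and p: "0 \<le> p" "p \<le> 1"
    and f[measurable]: "f \<in> borel_measurable borel" and bound: "\<And>x. norm (f x) \<le> B"
  shows "(\<integral>x. f x \<partial>mixture_law p \<mu> \<kappa>) = p *\<^sub>R (\<integral>x. f x \<partial>\<mu>) + (1 - p) *\<^sub>R (\<integral>x. f x \<partial>\<kappa>)"
proof -
  interpret \<mu>: real_distribution \<mu> by fact
  interpret \<kappa>: real_distribution \<kappa> by fact
  interpret \<mu>\<kappa>: pair_prob_space \<mu> \<kappa> ..
  interpret b\<mu>\<kappa>: pair_prob_space "measure_pmf (bernoulli_pmf p)" "\<mu> \<Otimes>\<^sub>M \<kappa>" ..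
  have [measurable_cong]: "sets \<mu> = sets borel" "sets \<kappa> = sets borel" by auto
  note mixture_law_measurable[OF \<mu> \<kappa>, measurable]
  have int1: "integrable (\<mu> \<Otimes>\<^sub>M \<kappa>) (\<lambda>z. f (fst z))" "integrable (\<mu> \<Otimes>\<^sub>M \<kappa>) (\<lambda>z. f (snd z))"
    by (rule \<mu>\<kappa>.integrable_const_bound[where B=B]; simp add: bound)+
  have int2: "integrable (measure_pmf (bernoulli_pmf p) \<Otimes>\<^sub>M (\<mu> \<Otimes>\<^sub>M \<kappa>))
      (\<lambda>z. f (case z of (b, x, y) \<Rightarrow> if b then x else y))"
    by (rule b\<mu>\<kappa>.integrable_const_bound[where B=B]; simp add: bound)
  have "(\<integral>x. f x \<partial>mixture_law p \<mu> \<kappa>)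
      = (\<integral>z. f (case z of (b, x, y) \<Rightarrow> if b then x else y) \<partial>(measure_pmf (bernoulli_pmf p) \<Otimes>\<^sub>M (\<mu> \<Otimes>\<^sub>M \<kappa>)))"
    unfolding mixture_law_def by (rule integral_distr) measurable
  also have "\<dots> = (\<integral>b. (\<integral>z. f (if b then fst z else snd z) \<partial>(\<mu> \<Otimes>\<^sub>M \<kappa>)) \<partial>bernoulli_pmf p)"
    using b\<mu>\<kappa>.integral_fst'[OF int2] by (simp add: split_beta)
  also have "\<dots> = p *\<^sub>R (\<integral>z. f (fst z) \<partial>(\<mu> \<Otimes>\<^sub>M \<kappa>)) + (1 - p) *\<^sub>R (\<integral>z. f (snd z) \<partial>(\<mu> \<Otimes>\<^sub>M \<kappa>))"
    using p by (subst integral_measure_pmf[of UNIV]) (auto simp: UNIV_bool)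
  also have "(\<integral>z. f (fst z) \<partial>(\<mu> \<Otimes>\<^sub>M \<kappa>)) = (\<integral>x. f x \<partial>\<mu>)"
    using \<mu>\<kappa>.integral_fst'[OF int1(1)] \<kappa>.prob_space by simp
  also have "(\<integral>z. f (snd z) \<partial>(\<mu> \<Otimes>\<^sub>M \<kappa>)) = (\<integral>x. f x \<partial>\<kappa>)"
    using \<mu>\<kappa>.integral_fst'[OF int1(2)] \<mu>.prob_space by simp
  finally show ?thesis .
qed

lemma cdf_mixture_law:
  assumes \<mu>: "real_distribution \<mu>" and \<kappa>: "real_distribution \<kappa>" and p: "0 \<le> p" "p \<le> 1"
  shows "cdf (mixture_law p \<mu> \<kappa>) x = p * cdf \<mu> x + (1 - p) * cdf \<kappa> x"
proof -
  interpret \<mu>: real_distribution \<mu> by fact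
  interpret \<kappa>: real_distribution \<kappa> by fact
  interpret m: real_distribution "mixture_law p \<mu> \<kappa>" by (rule real_distribution_mixture_law; fact)
  show ?thesis
    using integral_mixture_law[OF assms, of "indicator {..x} :: real \<Rightarrow> real" 1]
    by (simp add: cdf_def indicator_le_1)
qed

lemma real_distribution_neg_exponential:
  assumes "0 < \<nu>"
  shows "real_distribution (distr (density lborel (exponential_density \<nu>)) borel uminus)"
  by (intro prob_space.real_distribution_distr prob_space_exponential_density assms) simp

text \<open>The jump \<open>-U\<close>, with \<open>U\<close> exponential, either keeps the level positive (\<open>U < z\<close>, an elementary
  integral over \<open>[0, z]\<close>) or empties the queue, with probability \<open>e\<^bsup>-\<nu>z\<^esup>\<close>. The exponential density is what
  makes the result a combination of exponentials in \<open>z\<close>, and the exclusion \<open>s \<noteq> \<nu>\<close> comes from the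
  antiderivative of \<open>e\<^bsup>-(\<nu> - s)u\<^esup>\<close>.\<close>

lemma transform_reflected_neg_exponential:
  fixes s :: complex
  assumes \<nu>: "0 < \<nu>" and z: "0 \<le> z" and s: "s \<noteq> of_real \<nu>"
  shows "(\<integral>x. exp (- s * of_real (max 0 (z + x)))
            \<partial>distr (density lborel (exponential_density \<nu>)) borel uminus)
       = of_real \<nu> / (of_real \<nu> - s) * exp (- s * of_real z)
         - s / (of_real \<nu> - s) * exp (- of_real \<nu> * of_real z)"
proof -
  \<comment> \<open>\<open>F\<close> is an antiderivative of \<open>f\<close>, the integrand on the part where the queue does not empty.\<close>
  define F where "F u = - of_real \<nu> / (of_real \<nu> - s) * exp (- s * of_real z)
       * exp (- (of_real \<nu> - s) * of_real u)" for u :: real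
  define f where "f u = of_real \<nu> * exp (- of_real \<nu> * of_real u) * exp (- s * of_real (z - u))" for u :: real
  have ne: "of_real \<nu> - s \<noteq> 0" using s by auto
  have "has_bochner_integral lborel (\<lambda>u. indicator {0..z} u *\<^sub>R f u) (F z - F 0)"
  proof (rule has_bochner_integral_FTC_Icc)
    show "continuous_on {0..z} f" unfolding f_def by (intro continuous_intros)
    fix u
    have "((\<lambda>u. - of_real \<nu> / (of_real \<nu> - s) * exp (- s * of_real z) * exp (- (of_real \<nu> - s) * u))
       has_field_derivative f u) (at (of_real u))"
    proof -
      have "f u = of_real \<nu> * (exp (- s * of_real z) * exp (- (of_real \<nu> - s) * of_real u))"
        unfolding f_def exp_add[symmetric] mult.assoc by (simp add: algebra_simps)
      then show ?thesis
        using ne by (auto intro!: derivative_eq_intros simp: divide_simps) (simp add: algebra_simps)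
    qed
    then show "(F has_vector_derivative f u) (at u within {0..z})"
      unfolding F_def by (rule has_vector_derivative_real_field)
  qed (use z in auto)
  moreover have "has_bochner_integral lborel (\<lambda>u. indicator {z..} u *\<^sub>R complex_of_real (\<nu> * exp (- \<nu> * u)))
      (exp (- of_real \<nu> * of_real z))"
  proof -
    have "(\<integral>\<^sup>+u. ennreal (\<nu> * exp (- \<nu> * u)) * indicator {z..} u \<partial>lborel) = ennreal (0 - (- exp (- \<nu> * z)))"
    proof (rule nn_integral_FTC_atLeast)
      show "((\<lambda>u. - exp (- \<nu> * u)) \<longlongrightarrow> 0) at_top" using \<nu> by real_asymp
    qed (use \<nu> in \<open>auto intro!: derivative_eq_intros\<close>)
    then have "has_bochner_integral lborel (\<lambda>u. indicator {z..} u *\<^sub>R (\<nu> * exp (- \<nu> * u))) (exp (- \<nu> * z))"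
      using \<nu> by (intro has_bochner_integral_nn_integral)
        (auto simp: ennreal_mult'' ennreal_indicator mult.commute[of "indicator _ _"] )
    from has_bochner_integral_of_real[OF this, where 'a=complex]
    show ?thesis by (simp add: exp_of_real[symmetric] scaleR_conv_of_real)
  qed
  ultimately have sum: "has_bochner_integral lborel
      (\<lambda>u. indicator {0..z} u *\<^sub>R f u + indicator {z..} u *\<^sub>R complex_of_real (\<nu> * exp (- \<nu> * u)))
      (F z - F 0 + exp (- of_real \<nu> * of_real z))"
    by (rule has_bochner_integral_add)
  have "(\<integral>x. exp (- s * of_real (max 0 (z + x))) \<partial>distr (density lborel (exponential_density \<nu>)) borel uminus)
      = (\<integral>u. exponential_density \<nu> u *\<^sub>R exp (- s * of_real (max 0 (z - u))) \<partial>lborel)"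
    using \<nu> by (subst integral_distr, simp, simp, subst integral_density) (auto simp: exponential_density_nonneg)
  also have "\<dots> = (\<integral>u. indicator {0..z} u *\<^sub>R f u + indicator {z..} u *\<^sub>R complex_of_real (\<nu> * exp (- \<nu> * u)) \<partial>lborel)"
  proof (rule integral_cong_AE)
    show "AE u in lborel. exponential_density \<nu> u *\<^sub>R exp (- s * of_real (max 0 (z - u)))
        = indicator {0..z} u *\<^sub>R f u + indicator {z..} u *\<^sub>R complex_of_real (\<nu> * exp (- \<nu> * u))"
      using AE_lborel_singleton[of z]
      by eventually_elim
        (use z in \<open>auto simp: exponential_density_def f_def indicator_def scaleR_conv_of_real exp_of_real[symmetric] max_def mult.commute\<close>)
  qed (auto simp: f_def)
  also have "\<dots> = F z - F 0 + exp (- of_real \<nu> * of_real z)"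
    using sum by (rule has_bochner_integral_integral_eq)
  also have "F z = - of_real \<nu> / (of_real \<nu> - s) * exp (- of_real \<nu> * of_real z)"
  proof -
    have "exp (- s * of_real z) * exp (- (of_real \<nu> - s) * of_real z) = exp (- of_real \<nu> * complex_of_real z)"
      unfolding exp_add[symmetric] by (simp add: algebra_simps)
    then show ?thesis by (simp only: F_def mult.assoc)
  qed
  finally show ?thesis
    using ne by (simp add: F_def divide_simps) (simp add: algebra_simps)
qed

lemma AE_nonneg_law:
  assumes "nonneg_law \<mu>"
  shows "AE x in \<mu>. 0 \<le> x"
proof -
  interpret real_distribution \<mu> using assms by (simp add: nonneg_law_def)
  have "emeasure \<mu> {..<0} = 0"
    using assms by (simp add: nonneg_law_def emeasure_eq_measure)
  then show ?thesis by (intro AE_I'[of "{..<0}"]) (auto simp: null_sets_def)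
qed

section \<open>Laplace-Stieltjes transforms\<close>

lemma lst_eq_integral:
  assumes \<mu>: "nonneg_law \<mu>"
  shows "lst \<mu> s = (\<integral>x. exp (- s * of_real x) \<partial>\<mu>)"
proof -
  interpret real_distribution \<mu> using \<mu> by (simp add: nonneg_law_def)
  have [measurable_cong]: "sets \<mu> = sets borel" by simp
  show ?thesis unfolding lst_def set_lebesgue_integral_def
  proof (rule integral_cong_AE)
    show "AE x in \<mu>. indicator {0..} x *\<^sub>R exp (- s * complex_of_real x) = exp (- s * complex_of_real x)"
      using AE_nonneg_law[OF \<mu>] by eventually_elim (simp add: indicator_def)
  qed measurable
qed

lemma norm_exp_minus_mult_le_1:
  assumes "0 \<le> Re s" "0 \<le> x"
  shows "norm (exp (- s * complex_of_real x)) \<le> 1"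
  using assms by simp

lemma integrable_exp_minus_mult:
  assumes "finite_measure \<mu>" and [measurable]: "X \<in> borel_measurable \<mu>"
    and X: "AE \<omega> in \<mu>. 0 \<le> X \<omega>" and s: "0 \<le> Re s"
  shows "integrable \<mu> (\<lambda>\<omega>. exp (- s * complex_of_real (X \<omega>)))"
proof (rule finite_measure.integrable_const_bound[OF assms(1), of _ 1])
  show "AE \<omega> in \<mu>. norm (exp (- s * complex_of_real (X \<omega>))) \<le> 1"
    using X by eventually_elim (rule norm_exp_minus_mult_le_1[OF s])
qed measurable

lemma norm_lst_le_1:
  assumes \<mu>: "nonneg_law \<mu>" and s: "0 \<le> Re s"
  shows "norm (lst \<mu> s) \<le> 1"
proof -
  interpret real_distribution \<mu> using \<mu> by (simp add: nonneg_law_def)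
  have "norm (lst \<mu> s) \<le> (\<integral>x. norm (exp (- s * complex_of_real x)) \<partial>\<mu>)"
    unfolding lst_eq_integral[OF \<mu>] by (rule integral_norm_bound)
  also have "\<dots> \<le> 1"
  proof (rule integral_le_const)
    show "integrable \<mu> (\<lambda>x. norm (exp (- s * complex_of_real x)))"
      by (intro integrable_norm integrable_exp_minus_mult finite_measure_axioms AE_nonneg_law \<mu> s) simp
    show "AE x in \<mu>. norm (exp (- s * complex_of_real x)) \<le> 1"
      using AE_nonneg_law[OF \<mu>] by eventually_elim (rule norm_exp_minus_mult_le_1[OF s])
  qed
  finally show ?thesis .
qed

section \<open>The joint law of workload, service and jump\<close>

context modulated_shot_noise_queue
begin

definition jump_law :: "'n \<Rightarrow> real measure" where
  "jump_law j = mixture_law p (Cp j) (distr (density lborel (exponential_density (\<nu> j))) borel uminus)"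

lemma real_distribution_laws:
  "real_distribution (FS i)" "real_distribution (Cp j)" "real_distribution (jump_law j)"
proof -
  show "real_distribution (FS i)" "real_distribution (Cp j)" for i j
    using FS_law Cp_law by (auto simp: nonneg_law_def)
  then show "real_distribution (jump_law j)" unfolding jump_law_def
    by (intro real_distribution_mixture_law real_distribution_neg_exponential nu_pos)
qed

lemma cdf_jump_law: "cdf (jump_law j) x = jump_cdf p (Cp j) (\<nu> j) x"
  unfolding jump_law_def jump_cdf_def
  by (intro cdf_mixture_law real_distribution_laws real_distribution_neg_exponential nu_pos p_range)

lemma rv_measurable [measurable]:
  "W n \<in> borel_measurable M" "S n \<in> borel_measurable M" "C n \<in> borel_measurable M"
  "Y n \<in> M \<rightarrow>\<^sub>M count_space UNIV"
  using W_rv S_rv C_rv Y_chain by (auto simp: markov_chain_def)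

lemma P_nonneg: "0 \<le> P $ i $ j" and P_row_sum: "(\<Sum>j\<in>UNIV. P $ i $ j) = 1"
  using Y_chain by (auto simp: markov_chain_def stochastic_matrix_def)

text \<open>Conditionally on \<open>Y\<^sub>n = i\<close>, the event on the innovation \<open>(C\<^sub>n\<^sub>+\<^sub>1, S\<^sub>n, Y\<^sub>n\<^sub>+\<^sub>1)\<close> is independent of
  \<open>W\<^sub>n \<le> w\<close>, which belongs to the past. If \<open>Y\<^sub>n = i\<close> has probability zero, both sides vanish, so that the
  unconditional form holds for every \<open>i\<close>.\<close>

lemma joint_cdf:
  "prob {\<omega> \<in> space M. (Y n \<omega> = i \<and> Y (Suc n) \<omega> = j) \<and> W n \<omega> \<le> w \<and> S n \<omega> \<le> y \<and> C (Suc n) \<omega> \<le> x}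
     = P $ i $ j * prob {\<omega> \<in> space M. Y n \<omega> = i \<and> W n \<omega> \<le> w} * (cdf (FS i) y * jump_cdf p (Cp j) (\<nu> j) x)"
proof (cases "prob {\<omega> \<in> space M. Y n \<omega> = i} > 0")
  case False
  then have 0: "prob {\<omega> \<in> space M. Y n \<omega> = i} = 0"
    using measure_nonneg[of M "{\<omega> \<in> space M. Y n \<omega> = i}"] by linarith
  have null: "prob A = 0" if "A \<subseteq> {\<omega> \<in> space M. Y n \<omega> = i}" for A
    using finite_measure_mono[OF that] 0 measure_nonneg[of M A] by simp
  show ?thesis by (subst (1 2) null) auto
next
  case True
  let ?B = "{\<omega> \<in> space M. Y n \<omega> = i}"
  let ?V = "{\<omega> \<in> space M. W n \<omega> \<le> w}"
  let ?I = "{\<omega> \<in> space M. C (Suc n) \<omega> \<le> x \<and> S n \<omega> \<le> y \<and> Y (Suc n) \<omega> = j}"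
  let ?U = "uniform_measure M ?B"
  have B_pos: "emeasure M ?B \<noteq> 0" "emeasure M ?B \<noteq> \<infinity>"
    using True by (auto simp: emeasure_eq_measure)
  interpret U: prob_space ?U by (rule prob_space_uniform_measure[OF B_pos])
  have I: "?I \<in> innovation M Y S C n"
  proof -
    have "(\<lambda>\<omega>. (C (Suc n) \<omega>, S n \<omega>, Y (Suc n) \<omega>)) -` ({..x} \<times> {..y} \<times> {j}) \<inter> space M
        \<in> innovation M Y S C n"
      unfolding innovation_def by (rule in_vimage_algebra) simp
    also have "(\<lambda>\<omega>. (C (Suc n) \<omega>, S n \<omega>, Y (Suc n) \<omega>)) -` ({..x} \<times> {..y} \<times> {j}) \<inter> space M = ?I"
      by auto
    finally show ?thesis .
  qed
  have V: "?V \<in> past M Y W S C n"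
  proof -
    have "W n -` {..w} \<inter> space M \<in> sets (vimage_algebra (space M) (W n) borel)"
      by (rule in_vimage_algebra) simp
    then have "W n -` {..w} \<inter> space M \<in> past M Y W S C n"
      unfolding past_def by (intro sigma_sets.Basic UnI1 UN_I[of n]) auto
    also have "W n -` {..w} \<inter> space M = ?V" by auto
    finally show ?thesis .
  qed
  have cond: "measure ?U A = prob (?B \<inter> A) / prob ?B" if "A \<in> sets M" for A
    using that B_pos by (intro measure_uniform_measure) auto
  have "prob (?B \<inter> (?I \<inter> ?V)) / prob ?B = (prob (?B \<inter> ?I) / prob ?B) * (prob (?B \<inter> ?V) / prob ?B)"
    using U.indep_setD[OF innovation_indep[OF True] I V] by (simp add: cond)
  then have "prob (?B \<inter> (?I \<inter> ?V)) = (prob (?B \<inter> ?I) / prob ?B) * prob (?B \<inter> ?V)"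
    using True by (simp add: field_simps)
  moreover have "prob (?B \<inter> ?I) / prob ?B = P $ i $ j * cdf (FS i) y * jump_cdf p (Cp j) (\<nu> j) x"
    using innovation_law[OF True, of x y j] unfolding cond_prob_def
    by (simp add: Collect_conj_eq Int_ac conj_ac)
  moreover have "?B \<inter> (?I \<inter> ?V) = {\<omega> \<in> space M. (Y n \<omega> = i \<and> Y (Suc n) \<omega> = j) \<and> W n \<omega> \<le> w \<and> S n \<omega> \<le> y \<and> C (Suc n) \<omega> \<le> x}"
    "?B \<inter> ?V = {\<omega> \<in> space M. Y n \<omega> = i \<and> W n \<omega> \<le> w}" by auto
  ultimately show ?thesis by simp
qed

text \<open>The product form is stated for sub-probability measures, with the event \<open>Y\<^sub>n = i\<close> and the
  factor \<open>p\<^sub>i\<^sub>,\<^sub>j\<close> absorbed into the law of \<open>W\<^sub>n\<close>. This avoids conditioning on null events.\<close>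

lemma joint_law:
  "distr (density M (\<lambda>\<omega>. ennreal (indicator {\<omega>. Y n \<omega> = i \<and> Y (Suc n) \<omega> = j} \<omega>))) borel
       (\<lambda>\<omega>. (W n \<omega>, S n \<omega>, C (Suc n) \<omega>))
     = distr (density M (\<lambda>\<omega>. ennreal (P $ i $ j * indicator {\<omega>. Y n \<omega> = i} \<omega>))) borel (W n)
         \<Otimes>\<^sub>M (FS i \<Otimes>\<^sub>M jump_law j)"
  (is "distr ?D1 borel ?f = ?K \<Otimes>\<^sub>M _")
proof (rule finite_borel_measure_eqI_atMost)
  interpret F: real_distribution "FS i" by (rule real_distribution_laws)
  interpret G: real_distribution "jump_law j" by (rule real_distribution_laws)
  interpret FG: pair_prob_space "FS i" "jump_law j" ..
  have D1: "emeasure ?D1 {\<omega> \<in> space M. Q \<omega>} = emeasure M {\<omega> \<in> space M. (Y n \<omega> = i \<and> Y (Suc n) \<omega> = j) \<and> Q \<omega>}"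
    if [measurable]: "Measurable.pred M Q" for Q
  proof -
    have "emeasure ?D1 {\<omega> \<in> space M. Q \<omega>}
        = (\<integral>\<^sup>+\<omega>. indicator {\<omega> \<in> space M. (Y n \<omega> = i \<and> Y (Suc n) \<omega> = j) \<and> Q \<omega>} \<omega> \<partial>M)"
      by (simp add: emeasure_density del: nn_integral_indicator)
        (intro nn_integral_cong, auto simp: indicator_def)
    also have "\<dots> = emeasure M {\<omega> \<in> space M. (Y n \<omega> = i \<and> Y (Suc n) \<omega> = j) \<and> Q \<omega>}"
      by (rule nn_integral_indicator) measurable
    finally show ?thesis .
  qed
  have D2: "emeasure ?K {..w} = ennreal (P $ i $ j * prob {\<omega> \<in> space M. Y n \<omega> = i \<and> W n \<omega> \<le> w})" for w
  proof -
    have "emeasure ?K {..w}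
        = (\<integral>\<^sup>+\<omega>. ennreal (P $ i $ j) * indicator {\<omega> \<in> space M. Y n \<omega> = i \<and> W n \<omega> \<le> w} \<omega> \<partial>M)"
      by (simp add: emeasure_distr emeasure_density)
        (auto intro!: nn_integral_cong simp: indicator_def)
    also have "\<dots> = ennreal (P $ i $ j) * emeasure M {\<omega> \<in> space M. Y n \<omega> = i \<and> W n \<omega> \<le> w}"
      by (rule nn_integral_cmult_indicator) measurable
    finally show ?thesis by (simp add: emeasure_eq_measure ennreal_mult P_nonneg)
  qed
  show "finite_measure (distr ?D1 borel ?f)"
  proof
    have "emeasure ?D1 {\<omega> \<in> space M. True} \<noteq> \<infinity>" by (subst D1) auto
    then show "emeasure (distr ?D1 borel ?f) (space (distr ?D1 borel ?f)) \<noteq> \<infinity>"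
      by (subst emeasure_distr) auto
  qed
  show "sets (distr ?D1 borel ?f) = sets borel" by simp
  have "sets (?K \<Otimes>\<^sub>M (FS i \<Otimes>\<^sub>M jump_law j)) = sets (borel \<Otimes>\<^sub>M (borel \<Otimes>\<^sub>M borel))"
    by (intro sets_pair_measure_cong) auto
  then show "sets (?K \<Otimes>\<^sub>M (FS i \<Otimes>\<^sub>M jump_law j)) = sets borel"
    unfolding borel_prod .
  fix a :: "real \<times> real \<times> real"
  obtain w y x where a: "a = (w, y, x)" by (cases a)
  have Q: "Measurable.pred M (\<lambda>\<omega>. W n \<omega> \<le> w \<and> S n \<omega> \<le> y \<and> C (Suc n) \<omega> \<le> x)"
    by measurable
  have "emeasure (distr ?D1 borel ?f) {..a}
      = emeasure ?D1 {\<omega> \<in> space M. W n \<omega> \<le> w \<and> S n \<omega> \<le> y \<and> C (Suc n) \<omega> \<le> x}"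
    by (subst emeasure_distr) (auto simp: a intro!: arg_cong[where f="emeasure ?D1"])
  also have "\<dots> = ennreal (P $ i $ j * prob {\<omega> \<in> space M. Y n \<omega> = i \<and> W n \<omega> \<le> w} * (cdf (FS i) y * cdf (jump_law j) x))"
    unfolding D1[OF Q] emeasure_eq_measure joint_cdf cdf_jump_law ..
  also have "\<dots> = emeasure ?K {..w} * (emeasure (FS i) {..y} * emeasure (jump_law j) {..x})"
    unfolding D2 F.emeasure_eq_measure G.emeasure_eq_measure
    by (simp add: cdf_def ennreal_mult P_nonneg)
  also have "\<dots> = emeasure (?K \<Otimes>\<^sub>M (FS i \<Otimes>\<^sub>M jump_law j)) ({..w} \<times> {..y} \<times> {..x})"
    by (simp add: FG.emeasure_pair_measure_Times G.emeasure_pair_measure_Times)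
  also have "{..w} \<times> {..y} \<times> {..x} = {..a}" by (auto simp: a)
  finally show "emeasure (distr ?D1 borel ?f) {..a} = emeasure (?K \<Otimes>\<^sub>M (FS i \<Otimes>\<^sub>M jump_law j)) {..a}" .
qed

text \<open>The jump is integrated innermost because the truncation at \<open>0\<close> can be resolved once the level before
  the jump is fixed.\<close>

lemma integral_joint_law:
  fixes g :: "real \<times> real \<times> real \<Rightarrow> complex"
  assumes g[measurable]: "g \<in> borel_measurable borel"
    and bound: "\<And>z. norm (g z) \<le> B"
  shows "(\<integral>\<omega>. indicator {\<omega>. Y n \<omega> = i \<and> Y (Suc n) \<omega> = j} \<omega> *\<^sub>R g (W n \<omega>, S n \<omega>, C (Suc n) \<omega>) \<partial>M)
     = (\<integral>\<omega>. (P $ i $ j * indicator {\<omega>. Y n \<omega> = i} \<omega>) *\<^sub>R (\<integral>y. (\<integral>x. g (W n \<omega>, y, x) \<partial>jump_law j) \<partial>FS i) \<partial>M)"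
proof -
  interpret F: real_distribution "FS i" by (rule real_distribution_laws)
  interpret G: real_distribution "jump_law j" by (rule real_distribution_laws)
  interpret FG: pair_prob_space "FS i" "jump_law j" ..
  let ?d1 = "\<lambda>\<omega>. indicator {\<omega>. Y n \<omega> = i \<and> Y (Suc n) \<omega> = j} \<omega> :: real"
  let ?d2 = "\<lambda>\<omega>. P $ i $ j * indicator {\<omega>. Y n \<omega> = i} \<omega>"
  let ?K = "distr (density M (\<lambda>\<omega>. ennreal (?d2 \<omega>))) borel (W n)"
  interpret K: finite_measure ?K
  proof (intro finite_measure.finite_measure_distr finite_measureI)
    have "(\<integral>\<^sup>+\<omega>. ennreal (?d2 \<omega>) \<partial>M) \<le> (\<integral>\<^sup>+\<omega>. ennreal (P $ i $ j) \<partial>M)"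
      by (intro nn_integral_mono) (auto simp: indicator_def)
    then show "emeasure (density M (\<lambda>\<omega>. ennreal (?d2 \<omega>))) (space (density M (\<lambda>\<omega>. ennreal (?d2 \<omega>)))) \<noteq> \<infinity>"
      by (auto simp: emeasure_density emeasure_space_1 top_unique cong: nn_integral_cong)
  qed measurable
  interpret KFG: pair_sigma_finite ?K "FS i \<Otimes>\<^sub>M jump_law j" ..
  have fin: "finite_measure (?K \<Otimes>\<^sub>M (FS i \<Otimes>\<^sub>M jump_law j))"
    by (intro finite_measure_pair_measure K.finite_measure_axioms FG.finite_measure_axioms)
  have [measurable_cong]: "sets (FS i) = sets borel" "sets (jump_law j) = sets borel" by auto
  have [measurable]: "g \<in> borel_measurable (borel \<Otimes>\<^sub>M (borel \<Otimes>\<^sub>M borel))"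
    using g by (simp add: borel_prod)
  have gw: "(\<lambda>(y, x). g (w, y, x)) \<in> borel_measurable (FS i \<Otimes>\<^sub>M jump_law j)" for w
    using measurable_compose[OF _ g, of "\<lambda>z. (w, z)" "borel \<Otimes>\<^sub>M borel"]
    by (simp add: borel_prod split_beta')
  have int: "integrable (?K \<Otimes>\<^sub>M (FS i \<Otimes>\<^sub>M jump_law j)) g"
    by (rule finite_measure.integrable_const_bound[OF fin, of _ B]) (auto simp: bound split_beta)
  have int_w: "integrable (FS i \<Otimes>\<^sub>M jump_law j) (\<lambda>z. g (w, z))" for w
    using gw[of w] by (intro FG.integrable_const_bound[of _ B]) (auto simp: bound split_beta)
  have "(\<integral>\<omega>. ?d1 \<omega> *\<^sub>R g (W n \<omega>, S n \<omega>, C (Suc n) \<omega>) \<partial>M)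
      = (\<integral>z. g z \<partial>distr (density M (\<lambda>\<omega>. ennreal (?d1 \<omega>))) borel (\<lambda>\<omega>. (W n \<omega>, S n \<omega>, C (Suc n) \<omega>)))"
    by (subst integral_distr, measurable, subst integral_density) auto
  also have "\<dots> = (\<integral>z. g z \<partial>(?K \<Otimes>\<^sub>M (FS i \<Otimes>\<^sub>M jump_law j)))"
    by (simp only: joint_law)
  also have "\<dots> = (\<integral>w. (\<integral>z. g (w, z) \<partial>(FS i \<Otimes>\<^sub>M jump_law j)) \<partial>?K)"
    using KFG.integral_fst'[OF int] by (simp add: split_beta)
  also have "\<dots> = (\<integral>w. (\<integral>y. (\<integral>x. g (w, y, x) \<partial>jump_law j) \<partial>FS i) \<partial>?K)"
    using FG.integral_fst'[OF int_w] by simp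
  also have "\<dots> = (\<integral>\<omega>. ?d2 \<omega> *\<^sub>R (\<integral>y. (\<integral>x. g (W n \<omega>, y, x) \<partial>jump_law j) \<partial>FS i) \<partial>M)"
    by (subst integral_distr, measurable, subst integral_density) (auto simp: P_nonneg)
  finally show ?thesis .
qed
end

section \<open>One step of the queue\<close>

context modulated_shot_noise_queue
begin

abbreviation decay :: real where "decay \<equiv> exp (- r * t)"

text \<open>A nonnegative jump leaves a nonnegative level nonnegative, hence the truncation at \<open>0\<close> matters only
  for the exponential part of the mixture.\<close>

lemma jump_transform:
  fixes s :: complex
  assumes z: "0 \<le> z" and s: "0 \<le> Re s" "s \<noteq> of_real (\<nu> j)"
  shows "(\<integral>x. exp (- s * of_real (max 0 (z + x))) \<partial>jump_law j)
     = (of_real p * lst (Cp j) s + of_real (1 - p) * (of_real (\<nu> j) / (of_real (\<nu> j) - s))) * exp (- s * of_real z)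
       - s * of_real (1 - p) / (of_real (\<nu> j) - s) * exp (- of_real (\<nu> j) * of_real z)"
proof -
  interpret Cp: real_distribution "Cp j" by (rule real_distribution_laws)
  have [measurable_cong]: "sets (Cp j) = sets borel" by simp
  have "(\<integral>x. exp (- s * of_real (max 0 (z + x))) \<partial>Cp j)
      = (\<integral>x. exp (- s * of_real z) * exp (- s * of_real x) \<partial>Cp j)"
  proof (rule integral_cong_AE)
    show "AE x in Cp j. exp (- s * of_real (max 0 (z + x))) = exp (- s * of_real z) * exp (- s * of_real x)"
      using AE_nonneg_law[OF Cp_law]
      by eventually_elim (use z in \<open>simp add: max_def exp_add[symmetric] algebra_simps\<close>)
  qed measurable
  also have "\<dots> = exp (- s * of_real z) * lst (Cp j) s"
    by (simp add: lst_eq_integral[OF Cp_law])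
  finally have Cp: "(\<integral>x. exp (- s * of_real (max 0 (z + x))) \<partial>Cp j) = exp (- s * of_real z) * lst (Cp j) s" .
  have "(\<integral>x. exp (- s * of_real (max 0 (z + x))) \<partial>jump_law j)
    = p *\<^sub>R (\<integral>x. exp (- s * of_real (max 0 (z + x))) \<partial>Cp j)
      + (1 - p) *\<^sub>R (\<integral>x. exp (- s * of_real (max 0 (z + x)))
          \<partial>distr (density lborel (exponential_density (\<nu> j))) borel uminus)"
    unfolding jump_law_def using s(1)
    by (intro integral_mixture_law[where B=1] real_distribution_laws real_distribution_neg_exponential nu_pos p_range)
      auto
  note this[unfolded Cp transform_reflected_neg_exponential[OF nu_pos z s(2)]]
  then show ?thesis by (simp add: scaleR_conv_of_real algebra_simps)
qed

lemma service_jump_transform: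
  fixes s :: complex
  assumes w: "0 \<le> w" and s: "0 \<le> Re s" "s \<noteq> of_real (\<nu> j)"
  shows "(\<integral>y. (\<integral>x. exp (- s * of_real (max 0 (decay * (w + y) + x))) \<partial>jump_law j) \<partial>FS i)
     = (of_real p * lst (Cp j) s + of_real (1 - p) * (of_real (\<nu> j) / (of_real (\<nu> j) - s)))
         * lst (FS i) (s * of_real decay) * exp (- (s * of_real decay) * of_real w)
       - s * of_real (1 - p) / (of_real (\<nu> j) - s)
         * lst (FS i) (of_real (\<nu> j * decay)) * exp (- of_real (\<nu> j * decay) * of_real w)"
    (is "?L = ?k1 * _ * _ - ?k2 * _ * _")
proof -
  interpret F: real_distribution "FS i" by (rule real_distribution_laws)
  interpret G: real_distribution "jump_law j" by (rule real_distribution_laws)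
  have [measurable_cong]: "sets (FS i) = sets borel" "sets (jump_law j) = sets borel" by auto
  let ?e = "\<lambda>u y. exp (- u * of_real w) * exp (- u * complex_of_real y)"
  have int: "integrable (FS i) (\<lambda>y. exp (- u * complex_of_real y))" if "0 \<le> Re u" for u
    by (intro integrable_exp_minus_mult F.finite_measure_axioms AE_nonneg_law FS_law that) simp
  have re: "0 \<le> Re (s * of_real decay)" "0 \<le> Re (complex_of_real (\<nu> j * decay))"
    using s(1) nu_pos[of j] by auto
  have "?L = (\<integral>y. ?k1 * ?e (s * of_real decay) y - ?k2 * ?e (of_real (\<nu> j * decay)) y \<partial>FS i)"
  proof (rule integral_cong_AE)
    show "AE y in FS i. (\<integral>x. exp (- s * of_real (max 0 (decay * (w + y) + x))) \<partial>jump_law j)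
        = ?k1 * ?e (s * of_real decay) y - ?k2 * ?e (of_real (\<nu> j * decay)) y"
      using AE_nonneg_law[OF FS_law]
    proof eventually_elim
      fix y :: real assume "0 \<le> y"
      then have "0 \<le> decay * (w + y)" using w by simp
      from jump_transform[OF this s]
      show "(\<integral>x. exp (- s * of_real (max 0 (decay * (w + y) + x))) \<partial>jump_law j)
        = ?k1 * ?e (s * of_real decay) y - ?k2 * ?e (of_real (\<nu> j * decay)) y"
        unfolding exp_add[symmetric] by (simp add: algebra_simps)
    qed
  qed measurable
  also have "\<dots> = ?k1 * (exp (- (s * of_real decay) * of_real w) * lst (FS i) (s * of_real decay))
      - ?k2 * (exp (- of_real (\<nu> j * decay) * of_real w) * lst (FS i) (of_real (\<nu> j * decay)))"
    unfolding lst_eq_integral[OF FS_law]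
    by (subst Bochner_Integration.integral_diff)
      (use int[OF re(1)] int[OF re(2)] in \<open>auto intro!: integrable_mult_right\<close>)
  finally show ?thesis by (simp only: mult_ac)
qed

text \<open>Summing over the state \<open>i\<close> at time \<open>n\<close> turns the iterated integrals into the functional equation
  between two consecutive times. The transform at \<open>\<nu>\<^sub>j e\<^bsup>-rt\<^esup>\<close> stems from the truncation at \<open>0\<close>:
  \<open>e\<^bsup>-\<nu>z\<^esup>\<close> is the probability that a negative jump empties the queue from level \<open>z\<close>.\<close>

lemma joint_transform_step:
  fixes s :: complex
  assumes s: "0 \<le> Re s" "s \<noteq> of_real (\<nu> j)"
  shows "joint_transform M (W (Suc n)) (Y (Suc n)) j s
     = (of_real p * lst (Cp j) s + of_real (1 - p) * (of_real (\<nu> j) / (of_real (\<nu> j) - s)))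
         * (\<Sum>i\<in>UNIV. of_real (P $ i $ j) * lst (FS i) (s * of_real decay)
              * joint_transform M (W n) (Y n) i (s * of_real decay))
       - s * of_real (1 - p) / (of_real (\<nu> j) - s)
         * (\<Sum>i\<in>UNIV. of_real (P $ i $ j) * lst (FS i) (of_real (\<nu> j * decay))
              * joint_transform M (W n) (Y n) i (of_real (\<nu> j * decay)))"
    (is "_ = ?k1 * _ - ?k2 * _")
proof -
  define g :: "real \<times> real \<times> real \<Rightarrow> complex"
    where "g = (\<lambda>(w, y, x). exp (- s * of_real (max 0 (decay * (w + y) + x))))"
  have "(\<lambda>(w, y, x). exp (- s * of_real (max 0 (decay * (w + y) + x))))
      \<in> borel_measurable (borel \<Otimes>\<^sub>M (borel \<Otimes>\<^sub>M borel))" by measurable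
  then have g: "g \<in> borel_measurable borel" by (simp add: g_def borel_prod)
  have g_bound: "norm (g z) \<le> 1" for z
    using s(1) by (simp add: g_def split_beta)
  have W_step: "exp (- s * of_real (W (Suc n) \<omega>)) = g (W n \<omega>, S n \<omega>, C (Suc n) \<omega>)" if "\<omega> \<in> space M" for \<omega>
    using that by (simp add: g_def W_recursion)
  have int: "integrable M (\<lambda>\<omega>. exp (- u * complex_of_real (W n \<omega>)) * indicator {\<omega>. Y n \<omega> = i} \<omega>)"
    if "0 \<le> Re u" for u n i
  proof -
    have "integrable M (\<lambda>\<omega>. exp (- u * complex_of_real (W n \<omega>)))"
      using W_nonneg by (intro integrable_exp_minus_mult finite_measure_axioms that AE_I2) auto
    then have "integrable M (\<lambda>\<omega>. indicator {\<omega> \<in> space M. Y n \<omega> = i} \<omega> *\<^sub>R exp (- u * complex_of_real (W n \<omega>)))"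
      by (intro integrable_mult_indicator) measurable
    then show ?thesis
      by (rule Bochner_Integration.integrable_cong[OF refl, THEN iffD1, rotated]) (auto simp: indicator_def)
  qed
  have int_g: "integrable M (\<lambda>\<omega>. indicator {\<omega>. Y n \<omega> = i \<and> Y (Suc n) \<omega> = j} \<omega> *\<^sub>R g (W n \<omega>, S n \<omega>, C (Suc n) \<omega>))" for i
  proof (rule integrable_const_bound[of _ 1])
    have [measurable]: "g \<in> borel_measurable (borel \<Otimes>\<^sub>M (borel \<Otimes>\<^sub>M borel))" using g by (simp add: borel_prod)
    show "(\<lambda>\<omega>. indicator {\<omega>. Y n \<omega> = i \<and> Y (Suc n) \<omega> = j} \<omega> *\<^sub>R g (W n \<omega>, S n \<omega>, C (Suc n) \<omega>)) \<in> borel_measurable M"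
      by measurable
  qed (use g_bound in \<open>auto simp: indicator_def\<close>)
  have re: "0 \<le> Re (s * of_real decay)" "0 \<le> Re (complex_of_real (\<nu> j * decay))"
    using s(1) nu_pos[of j] by auto
  have "joint_transform M (W (Suc n)) (Y (Suc n)) j s
     = (\<integral>\<omega>. (\<Sum>i\<in>UNIV. indicator {\<omega>. Y n \<omega> = i \<and> Y (Suc n) \<omega> = j} \<omega> *\<^sub>R g (W n \<omega>, S n \<omega>, C (Suc n) \<omega>)) \<partial>M)"
    unfolding joint_transform_def
  proof (rule Bochner_Integration.integral_cong[OF refl])
    fix \<omega> assume \<omega>: "\<omega> \<in> space M"
    have "(\<Sum>i\<in>UNIV. indicator {\<omega>. Y n \<omega> = i \<and> Y (Suc n) \<omega> = j} \<omega> *\<^sub>R g (W n \<omega>, S n \<omega>, C (Suc n) \<omega>))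
        = (\<Sum>i\<in>UNIV. if i = Y n \<omega> then indicator {\<omega>. Y (Suc n) \<omega> = j} \<omega> *\<^sub>R g (W n \<omega>, S n \<omega>, C (Suc n) \<omega>) else 0)"
      by (intro sum.cong) (auto simp: indicator_def)
    then show "exp (- s * of_real (W (Suc n) \<omega>)) * indicator {\<omega>. Y (Suc n) \<omega> = j} \<omega>
        = (\<Sum>i\<in>UNIV. indicator {\<omega>. Y n \<omega> = i \<and> Y (Suc n) \<omega> = j} \<omega> *\<^sub>R g (W n \<omega>, S n \<omega>, C (Suc n) \<omega>))"
      unfolding W_step[OF \<omega>] by (simp add: indicator_def)
  qed
  also have "\<dots> = (\<Sum>i\<in>UNIV. \<integral>\<omega>. indicator {\<omega>. Y n \<omega> = i \<and> Y (Suc n) \<omega> = j} \<omega> *\<^sub>R g (W n \<omega>, S n \<omega>, C (Suc n) \<omega>) \<partial>M)"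
    by (rule Bochner_Integration.integral_sum) (rule int_g)
  also have "\<dots> = (\<Sum>i\<in>UNIV. ?k1 * (of_real (P $ i $ j) * lst (FS i) (s * of_real decay)
              * joint_transform M (W n) (Y n) i (s * of_real decay))
         - ?k2 * (of_real (P $ i $ j) * lst (FS i) (of_real (\<nu> j * decay))
              * joint_transform M (W n) (Y n) i (of_real (\<nu> j * decay))))"
  proof (rule sum.cong[OF refl])
    fix i
    let ?e = "\<lambda>u \<omega>. exp (- u * complex_of_real (W n \<omega>)) * indicator {\<omega>. Y n \<omega> = i} \<omega>"
    let ?c1 = "?k1 * (of_real (P $ i $ j) * lst (FS i) (s * of_real decay))"
    let ?c2 = "?k2 * (of_real (P $ i $ j) * lst (FS i) (of_real (\<nu> j * decay)))"
    have "(\<integral>\<omega>. indicator {\<omega>. Y n \<omega> = i \<and> Y (Suc n) \<omega> = j} \<omega> *\<^sub>R g (W n \<omega>, S n \<omega>, C (Suc n) \<omega>) \<partial>M)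
        = (\<integral>\<omega>. (P $ i $ j * indicator {\<omega>. Y n \<omega> = i} \<omega>) *\<^sub>R (\<integral>y. (\<integral>x. g (W n \<omega>, y, x) \<partial>jump_law j) \<partial>FS i) \<partial>M)"
      by (rule integral_joint_law[OF g g_bound])
    also have "\<dots> = (\<integral>\<omega>. ?c1 * ?e (s * of_real decay) \<omega> - ?c2 * ?e (of_real (\<nu> j * decay)) \<omega> \<partial>M)"
    proof (rule Bochner_Integration.integral_cong[OF refl])
      fix \<omega> assume "\<omega> \<in> space M"
      from service_jump_transform[OF W_nonneg[OF this, of n] s, of i]
      show "(P $ i $ j * indicator {\<omega>. Y n \<omega> = i} \<omega>) *\<^sub>R (\<integral>y. (\<integral>x. g (W n \<omega>, y, x) \<partial>jump_law j) \<partial>FS i)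
          = ?c1 * ?e (s * of_real decay) \<omega> - ?c2 * ?e (of_real (\<nu> j * decay)) \<omega>"
        by (simp only: g_def prod.case) (simp add: scaleR_conv_of_real indicator_def right_diff_distrib mult_ac)
    qed
    also have "\<dots> = ?c1 * joint_transform M (W n) (Y n) i (s * of_real decay)
        - ?c2 * joint_transform M (W n) (Y n) i (of_real (\<nu> j * decay))"
      unfolding joint_transform_def
      using int[OF re(1)] int[OF re(2)]
      by (subst Bochner_Integration.integral_diff) (auto intro!: integrable_mult_right)
    finally show "(\<integral>\<omega>. indicator {\<omega>. Y n \<omega> = i \<and> Y (Suc n) \<omega> = j} \<omega> *\<^sub>R g (W n \<omega>, S n \<omega>, C (Suc n) \<omega>) \<partial>M)
        = ?k1 * (of_real (P $ i $ j) * lst (FS i) (s * of_real decay)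
              * joint_transform M (W n) (Y n) i (s * of_real decay))
         - ?k2 * (of_real (P $ i $ j) * lst (FS i) (of_real (\<nu> j * decay))
              * joint_transform M (W n) (Y n) i (of_real (\<nu> j * decay)))"
      by (simp only: mult.assoc)
  qed
  also have "\<dots> = ?k1 * (\<Sum>i\<in>UNIV. of_real (P $ i $ j) * lst (FS i) (s * of_real decay)
              * joint_transform M (W n) (Y n) i (s * of_real decay))
       - ?k2 * (\<Sum>i\<in>UNIV. of_real (P $ i $ j) * lst (FS i) (of_real (\<nu> j * decay))
              * joint_transform M (W n) (Y n) i (of_real (\<nu> j * decay)))"
    by (simp only: sum_subtractf sum_distrib_left)
  finally show ?thesis .
qed

end

section \<open>Linear recursions with almost contracting matrices\<close>

definition l1norm :: "complex^'n \<Rightarrow> real" where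
  "l1norm v = (\<Sum>i\<in>UNIV. norm (v $ i))"

lemma norm_le_l1norm: "norm v \<le> l1norm v"
  unfolding norm_vec_def l1norm_def by (rule L2_set_le_sum) simp

lemma l1norm_le_norm: "l1norm (v :: complex^'n) \<le> of_nat CARD('n) * norm v"
  unfolding l1norm_def by (rule order_trans[OF sum_bounded_above[of _ _ "norm v"]]) (auto simp: Finite_Cartesian_Product.norm_nth_le)

text \<open>The bound is uniform in \<open>n\<close> as soon as \<open>e\<close> is summable, although the matrices need not be
  contractions.\<close>

lemma l1norm_matrix_prod_le:
  assumes A: "\<And>k v. l1norm (A k *v v) \<le> (1 + e k) * l1norm v"
    and e: "\<And>k. 0 \<le> e k"
  shows "l1norm (matrix_prod A n *v v) \<le> exp (\<Sum>k<n. e k) * l1norm v"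
proof (induction n arbitrary: v)
  case (Suc n)
  have "l1norm (matrix_prod A (Suc n) *v v) = l1norm (matrix_prod A n *v (A n *v v))"
    by (simp add: matrix_vector_mul_assoc)
  also have "\<dots> \<le> exp (\<Sum>k<n. e k) * l1norm (A n *v v)" by (rule Suc)
  also have "\<dots> \<le> exp (\<Sum>k<n. e k) * ((1 + e n) * l1norm v)"
    by (intro mult_left_mono A) auto
  also have "\<dots> \<le> exp (\<Sum>k<n. e k) * (exp (e n) * l1norm v)"
    by (intro mult_left_mono mult_right_mono) (auto simp: l1norm_def sum_nonneg)
  finally show ?case by (simp add: exp_add mult_ac)
qed simp

text \<open>Iterating the recursion \<open>n\<close> times expresses \<open>z 0\<close> by a partial sum and the remainder
  \<open>A 0 \<dots> A (n - 1) z n\<close>. Since the partial products are bounded, \<open>z n\<close> may be replaced by its limit \<open>x\<close>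
  in the remainder, so convergence of the series entails convergence of the products applied to \<open>x\<close>,
  however slowly \<open>z n\<close> tends to \<open>x\<close>.\<close>

lemma linear_recursion_solution:
  fixes A :: "nat \<Rightarrow> complex^'n^'n" and z b :: "nat \<Rightarrow> complex^'n"
  assumes rec: "\<And>k. z k = A k *v z (Suc k) + b k"
    and A: "\<And>k v. l1norm (A k *v v) \<le> (1 + e k) * l1norm v"
    and e: "\<And>k. 0 \<le> e k" "summable e"
    and b: "summable (\<lambda>k. norm (b k))"
    and z: "z \<longlonglongrightarrow> x"
  shows "summable (\<lambda>n. matrix_prod A n *v b n)"
    and "convergent (\<lambda>n. matrix_prod A (Suc n) *v x)"
    and "z 0 = (\<Sum>n. matrix_prod A n *v b n) + lim (\<lambda>n. matrix_prod A (Suc n) *v x)"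
proof -
  define K where "K = exp (suminf e) * of_nat CARD('n)"
  have bound: "norm (matrix_prod A n *v v) \<le> K * norm v" for n v
  proof -
    have "norm (matrix_prod A n *v v) \<le> l1norm (matrix_prod A n *v v)" by (rule norm_le_l1norm)
    also have "\<dots> \<le> exp (\<Sum>k<n. e k) * l1norm v" by (rule l1norm_matrix_prod_le[OF A e(1)])
    also have "\<dots> \<le> exp (suminf e) * (of_nat CARD('n) * norm v)"
      using e by (intro mult_mono l1norm_le_norm) (auto intro: sum_le_suminf simp: l1norm_def sum_nonneg)
    finally show ?thesis by (simp add: K_def mult_ac)
  qed
  show summable: "summable (\<lambda>n. matrix_prod A n *v b n)"
    by (rule summable_comparison_test'[OF summable_mult[OF b, of K] bound])
  have iterate: "z 0 = (\<Sum>k<n. matrix_prod A k *v b k) + matrix_prod A n *v z n" for n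
  proof (induction n)
    case (Suc n)
    have "matrix_prod A n *v z n = matrix_prod A (Suc n) *v z (Suc n) + matrix_prod A n *v b n"
      by (subst rec) (simp add: matrix_vector_right_distrib matrix_vector_mul_assoc)
    then show ?case using Suc by simp
  qed simp
  have remainder: "(\<lambda>n. matrix_prod A n *v (z n - x)) \<longlonglongrightarrow> 0"
  proof (rule Lim_null_comparison)
    show "\<forall>\<^sub>F n in sequentially. norm (matrix_prod A n *v (z n - x)) \<le> K * norm (z n - x)"
      using bound by simp
    show "(\<lambda>n. K * norm (z n - x)) \<longlonglongrightarrow> 0"
      using tendsto_mult_right_zero[OF tendsto_norm_zero[OF LIM_zero[OF z]]] by simp
  qed
  have "matrix_prod A n *v x
      = z 0 - (\<Sum>k<n. matrix_prod A k *v b k) - matrix_prod A n *v (z n - x)" for n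
    by (subst iterate[of n]) (simp add: matrix_vector_mult_diff_distrib)
  then have "(\<lambda>n. matrix_prod A n *v x) \<longlonglongrightarrow> z 0 - (\<Sum>n. matrix_prod A n *v b n) - 0"
    by (simp only:) (intro tendsto_diff tendsto_const summable_LIMSEQ summable remainder)
  then have lim: "(\<lambda>n. matrix_prod A (Suc n) *v x) \<longlonglongrightarrow> z 0 - (\<Sum>n. matrix_prod A n *v b n)"
    by (simp only: diff_0_right) (rule LIMSEQ_Suc)
  then show "convergent (\<lambda>n. matrix_prod A (Suc n) *v x)" by (rule convergentI)
  show "z 0 = (\<Sum>n. matrix_prod A n *v b n) + lim (\<lambda>n. matrix_prod A (Suc n) *v x)"
    using limI[OF lim] by simp
qed

section \<open>The coefficient matrices\<close>

lemma diag_matrix_mult_vector: "(diag_matrix d *v v) $ i = d i * v $ i"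
proof -
  have "(\<Sum>k\<in>UNIV. (if i = k then d i else 0) * v $ k) = (\<Sum>k\<in>UNIV. if i = k then d i * v $ k else 0)"
    by (rule sum.cong) auto
  then show ?thesis by (simp add: diag_matrix_def matrix_vector_mult_def)
qed

lemma C_mat_eq_diag_matrix:
  "C_mat p Cp \<nu> s
     = diag_matrix (\<lambda>j. of_real p * lst (Cp j) s + of_real (1 - p) * (of_real (\<nu> j) / (of_real (\<nu> j) - s)))"
  by (simp add: vec_eq_iff C_mat_def L_mat_def diag_matrix_def) (simp add: scaleR_conv_of_real)

lemma H_mat_mult_vector:
  "(H_mat r t p P FS Cp \<nu> s *v v) $ j
     = (of_real p * lst (Cp j) s + of_real (1 - p) * (of_real (\<nu> j) / (of_real (\<nu> j) - s)))
       * (\<Sum>i\<in>UNIV. of_real (P $ i $ j) * lst (FS i) (s * of_real (exp (- r * t))) * v $ i)"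
proof -
  have "(H_mat r t p P FS Cp \<nu> s *v v) $ j
      = (C_mat p Cp \<nu> s *v (transpose (of_real_matrix P) *v (B_mat FS (s * of_real (exp (- r * t))) *v v))) $ j"
    by (simp only: H_mat_def matrix_vector_mul_assoc matrix_mul_assoc)
  also have "\<dots> = (of_real p * lst (Cp j) s + of_real (1 - p) * (of_real (\<nu> j) / (of_real (\<nu> j) - s)))
      * (\<Sum>i\<in>UNIV. transpose (of_real_matrix P) $ j $ i * (B_mat FS (s * of_real (exp (- r * t))) *v v) $ i)"
    by (simp only: C_mat_eq_diag_matrix diag_matrix_mult_vector matrix_vector_mult_def[of "transpose (of_real_matrix P)"] vec_lambda_beta)
  finally show ?thesis
    by (simp only: B_mat_def diag_matrix_mult_vector)
      (simp add: transpose_def of_real_matrix_def mult.assoc)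
qed

lemma Q_vec_nth:
  assumes "s \<noteq> of_real (\<nu> j)"
  shows "Q_vec r t p P FS \<nu> Z s $ j
     = - (s * of_real (1 - p) / (of_real (\<nu> j) - s)) * r_vec r t P FS \<nu> Z $ j"
proof -
  have "Q_vec r t p P FS \<nu> Z s $ j
      = of_real (1 - p) * (r_vec r t P FS \<nu> Z $ j - of_real (\<nu> j) / (of_real (\<nu> j) - s) * r_vec r t P FS \<nu> Z $ j)"
    by (simp add: Q_vec_def L_mat_def diag_matrix_mult_vector matrix_vector_mult_diff_rdistrib)
      (simp add: scaleR_conv_of_real)
  also have "\<dots> = of_real (1 - p) * (1 - of_real (\<nu> j) / (of_real (\<nu> j) - s)) * r_vec r t P FS \<nu> Z $ j"
    by (simp add: algebra_simps)
  also have "1 - of_real (\<nu> j) / (of_real (\<nu> j) - s) = - s / (of_real (\<nu> j) - s)"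
    using assms by (simp add: divide_simps)
  finally show ?thesis by simp
qed

section \<open>The steady state\<close>

text \<open>Dominated convergence, which is where finiteness of the random variable \<open>X\<close> enters. It yields
  both \<open>Z(0) = \<pi>\<close> and the continuity of \<open>Z\<close> at \<open>0\<close>.\<close>

lemma joint_transform_tendsto:
  fixes s :: "nat \<Rightarrow> complex"
  assumes "prob_space M" and [measurable]: "X \<in> borel_measurable M" "Y \<in> M \<rightarrow>\<^sub>M count_space UNIV"
    and X: "AE \<omega> in M. 0 \<le> X \<omega>" and s: "\<And>n. 0 \<le> Re (s n)" "s \<longlonglongrightarrow> 0"
  shows "(\<lambda>n. joint_transform M X Y i (s n)) \<longlonglongrightarrow> of_real \<P>(\<omega> in M. Y \<omega> = i)"
proof -
  interpret prob_space M by fact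
  have "(\<lambda>n. joint_transform M X Y i (s n)) \<longlonglongrightarrow> joint_transform M X Y i 0"
    unfolding joint_transform_def
  proof (rule integral_dominated_convergence[where w="\<lambda>_. 1"])
    show "AE \<omega> in M. (\<lambda>n. exp (- s n * complex_of_real (X \<omega>)) * indicator {\<omega>. Y \<omega> = i} \<omega>)
        \<longlonglongrightarrow> exp (- 0 * complex_of_real (X \<omega>)) * indicator {\<omega>. Y \<omega> = i} \<omega>"
      by (intro AE_I2 tendsto_intros s)
    show "AE \<omega> in M. norm (exp (- s n * complex_of_real (X \<omega>)) * indicator {\<omega>. Y \<omega> = i} \<omega>) \<le> 1" for n
      using X by eventually_elim (use s(1) in \<open>auto simp: indicator_def\<close>)
  qed (simp_all add: measurable_If_set)
  also have "joint_transform M X Y i 0 = of_real \<P>(\<omega> in M. Y \<omega> = i)"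
  proof -
    have "joint_transform M X Y i 0 = (\<integral>\<omega>. complex_of_real (indicator {\<omega> \<in> space M. Y \<omega> = i} \<omega>) \<partial>M)"
      unfolding joint_transform_def by (rule Bochner_Integration.integral_cong) (auto simp: indicator_def)
    then show ?thesis by simp
  qed
  finally show ?thesis .
qed

context modulated_shot_noise_queue
begin

lemma steady_state_equation:
  fixes s :: complex
  assumes steady: "steady_state M Y W \<pi> M' Winf Yinf Z"
    and s: "0 \<le> Re s" "s \<noteq> of_real (\<nu> j)"
  shows "Z j s
     = (of_real p * lst (Cp j) s + of_real (1 - p) * (of_real (\<nu> j) / (of_real (\<nu> j) - s)))
         * (\<Sum>i\<in>UNIV. of_real (P $ i $ j) * lst (FS i) (s * of_real decay) * Z i (s * of_real decay))
       - s * of_real (1 - p) / (of_real (\<nu> j) - s)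
         * (\<Sum>i\<in>UNIV. of_real (P $ i $ j) * lst (FS i) (of_real (\<nu> j * decay)) * Z i (of_real (\<nu> j * decay)))"
proof (rule LIMSEQ_unique)
  have lim: "(\<lambda>n. joint_transform M (W n) (Y n) i u) \<longlonglongrightarrow> Z i u" if "0 \<le> Re u" for i u
    using steady that unfolding steady_state_def by blast
  show "(\<lambda>n. joint_transform M (W (Suc n)) (Y (Suc n)) j s) \<longlonglongrightarrow> Z j s"
    by (rule LIMSEQ_Suc[OF lim[OF s(1)]])
  have re: "0 \<le> Re (s * of_real decay)" "0 \<le> Re (complex_of_real (\<nu> j * decay))"
    using s(1) nu_pos[of j] by auto
  show "(\<lambda>n. joint_transform M (W (Suc n)) (Y (Suc n)) j s) \<longlonglongrightarrow>
     (of_real p * lst (Cp j) s + of_real (1 - p) * (of_real (\<nu> j) / (of_real (\<nu> j) - s)))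
         * (\<Sum>i\<in>UNIV. of_real (P $ i $ j) * lst (FS i) (s * of_real decay) * Z i (s * of_real decay))
       - s * of_real (1 - p) / (of_real (\<nu> j) - s)
         * (\<Sum>i\<in>UNIV. of_real (P $ i $ j) * lst (FS i) (of_real (\<nu> j * decay)) * Z i (of_real (\<nu> j * decay)))"
    unfolding joint_transform_step[OF s]
    by (intro tendsto_diff tendsto_mult tendsto_sum tendsto_const lim re)
qed

lemma steady_state_recursion:
  assumes steady: "steady_state M Y W \<pi> M' Winf Yinf Z"
    and s: "0 \<le> Re s" "\<And>j. s \<noteq> of_real (\<nu> j)"
  shows "(\<chi> j. Z j s) = H_mat r t p P FS Cp \<nu> s *v (\<chi> j. Z j (s * of_real decay)) + Q_vec r t p P FS \<nu> Z s"
  unfolding vec_eq_iff vector_add_component H_mat_mult_vector Q_vec_nth[OF s(2)]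
  by (simp only: vec_lambda_beta steady_state_equation[OF steady s(1) s(2)] r_vec_def) simp

text \<open>The \<open>\<ell>\<^sup>1\<close>-norm is the right one because the rows of \<open>P\<close> sum to \<open>1\<close>, so that \<open>P\<^sup>T\<close> is an
  \<open>\<ell>\<^sup>1\<close>-contraction. Only the factor \<open>\<nu> / (\<nu> - s)\<close> can exceed \<open>1\<close> in modulus, and it does so by at
  most \<open>|s / (\<nu> - s)|\<close>.\<close>

lemma l1norm_H_mat_le:
  assumes s: "0 \<le> Re s" "\<And>j. s \<noteq> of_real (\<nu> j)"
    and e: "\<And>j. norm (s / (of_real (\<nu> j) - s)) \<le> e"
  shows "l1norm (H_mat r t p P FS Cp \<nu> s *v v) \<le> (1 + e) * l1norm v"
proof -
  have e0: "0 \<le> e" using e norm_ge_zero order_trans by blast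
  have c: "norm (of_real p * lst (Cp j) s + of_real (1 - p) * (of_real (\<nu> j) / (of_real (\<nu> j) - s))) \<le> 1 + e" for j
  proof -
    have "of_real (\<nu> j) / (of_real (\<nu> j) - s) = 1 + s / (of_real (\<nu> j) - s)"
      using s(2)[of j] by (simp add: divide_simps)
    then have "norm (of_real (\<nu> j) / (of_real (\<nu> j) - s)) \<le> 1 + e"
      using norm_triangle_ineq[of 1 "s / (of_real (\<nu> j) - s)"] e[of j] by simp
    then have 1: "norm (of_real (1 - p) * (of_real (\<nu> j) / (of_real (\<nu> j) - s))) \<le> (1 - p) * (1 + e)"
      using p_range mult_left_mono[of "norm (of_real (\<nu> j) / (of_real (\<nu> j) - s))" "1 + e" "1 - p"]
      by (simp only: norm_mult norm_of_real) simp
    have 2: "norm (of_real p * lst (Cp j) s) \<le> p * 1"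
      using p_range norm_lst_le_1[OF Cp_law s(1), of j] by (simp add: norm_mult mult_left_le)
    have "norm (of_real p * lst (Cp j) s + of_real (1 - p) * (of_real (\<nu> j) / (of_real (\<nu> j) - s)))
        \<le> p * 1 + (1 - p) * (1 + e)"
      using norm_triangle_le[OF add_mono[OF 2 1]] .
    also have "\<dots> \<le> 1 + e" using p_range e0 by (simp add: algebra_simps)
    finally show ?thesis .
  qed
  have "l1norm (H_mat r t p P FS Cp \<nu> s *v v)
      \<le> (\<Sum>j\<in>UNIV. (1 + e) * (\<Sum>i\<in>UNIV. P $ i $ j * norm (v $ i)))"
    unfolding l1norm_def H_mat_mult_vector norm_mult
  proof (intro sum_mono mult_mono c sum_norm_le)
    fix i j
    have "norm (lst (FS i) (s * of_real (exp (- r * t)))) \<le> 1"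
      using s(1) by (intro norm_lst_le_1 FS_law) simp
    then show "norm (of_real (P $ i $ j) * lst (FS i) (s * of_real (exp (- r * t))) * v $ i) \<le> P $ i $ j * norm (v $ i)"
      using P_nonneg[of i j] by (auto simp: norm_mult intro!: mult_right_mono mult_left_le)
  qed (use e0 in auto)
  also have "\<dots> = (1 + e) * (\<Sum>i\<in>UNIV. \<Sum>j\<in>UNIV. P $ i $ j * norm (v $ i))"
    by (simp only: sum_distrib_left[symmetric]) (subst sum.swap, rule refl)
  also have "\<dots> = (1 + e) * l1norm v"
    by (simp only: sum_distrib_right[symmetric] P_row_sum l1norm_def mult_1)
  finally show ?thesis .
qed

text \<open>Along \<open>e\<^bsup>-rtn\<^esup> s\<close> the same geometric sequence \<open>e\<close> controls the excess of the norm of \<open>H\<close> over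
  \<open>1\<close> and, up to a constant factor, the size of \<open>Q\<close>.\<close>

lemma steady_state_series:
  fixes s :: complex
  assumes steady: "steady_state M Y W \<pi> M' Winf Yinf Z"
    and s: "0 \<le> Re s" "\<And>n j. of_real (exp (- r * t * real n)) * s \<noteq> of_real (\<nu> j)"
  defines "A \<equiv> \<lambda>n. H_mat r t p P FS Cp \<nu> (of_real (exp (- r * t * real n)) * s)"
    and "b \<equiv> \<lambda>n. Q_vec r t p P FS \<nu> Z (of_real (exp (- r * t * real n)) * s)"
  shows "summable (\<lambda>n. matrix_prod A n *v b n)"
    and "convergent (\<lambda>n. matrix_prod A (Suc n) *v of_real_vec \<pi>)"
    and "(\<chi> j. Z j s) = (\<Sum>n. matrix_prod A n *v b n) + lim (\<lambda>n. matrix_prod A (Suc n) *v of_real_vec \<pi>)"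
proof -
  define u where "u n = of_real (exp (- r * t * real n)) * s" for n
  have decay: "0 < decay" "decay < 1" using r_pos t_pos by auto
  have u_eq: "u n = of_real (decay ^ n) * s" for n
    by (simp add: u_def exp_of_nat_mult[symmetric] mult_ac)
  have u_Suc: "u (Suc n) = u n * of_real decay" for n by (simp add: u_eq)
  have u_re: "0 \<le> Re (u n)" for n using s(1) by (simp add: u_def)
  have u_ne: "u n \<noteq> of_real (\<nu> j)" for n j using s(2) by (simp add: u_def)
  have u_lim: "u \<longlonglongrightarrow> 0"
  proof -
    have "(\<lambda>n. of_real (decay ^ n) * s) \<longlonglongrightarrow> of_real 0 * s"
      using decay by (intro tendsto_mult tendsto_of_real tendsto_const LIMSEQ_power_zero) simp
    then show ?thesis unfolding u_eq by simp
  qed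
  \<comment> \<open>The points \<open>u n\<close> avoid \<open>\<nu> j\<close> and converge to \<open>0\<close>, hence stay at a positive distance from it.\<close>
  have "\<exists>K. \<forall>n. norm (1 / (of_real (\<nu> j) - u n)) \<le> K" for j
  proof -
    have "(\<lambda>n. 1 / (of_real (\<nu> j) - u n)) \<longlonglongrightarrow> 1 / (of_real (\<nu> j) - 0)"
      using nu_pos[of j] by (intro tendsto_intros u_lim) simp
    then have "Bseq (\<lambda>n. 1 / (of_real (\<nu> j) - u n))"
      by (intro convergent_imp_Bseq convergentI)
    then show ?thesis by (auto simp: Bseq_def)
  qed
  then obtain K where K: "\<And>j n. norm (1 / (of_real (\<nu> j) - u n)) \<le> K j" by metis
  define e where "e n = (\<Sum>j\<in>UNIV. K j) * norm s * decay ^ n" for n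
  have K0: "0 \<le> K j" for j using K[of j 0] norm_ge_zero order_trans by blast
  have e: "norm (u n / (of_real (\<nu> j) - u n)) \<le> e n" for n j
  proof -
    have "norm (u n / (of_real (\<nu> j) - u n)) = norm (1 / (of_real (\<nu> j) - u n)) * (norm s * decay ^ n)"
      using decay by (simp add: u_eq norm_mult norm_divide norm_power)
    also have "\<dots> \<le> (\<Sum>j\<in>UNIV. K j) * (norm s * decay ^ n)"
      using decay K[of j n] member_le_sum[of j UNIV K] K0
      by (intro mult_right_mono) (auto intro: order_trans)
    finally show ?thesis by (simp add: e_def)
  qed
  have e_nonneg: "0 \<le> e n" for n
    using decay by (simp add: e_def sum_nonneg K0)
  have e_summable: "summable e"
    unfolding e_def using decay by (intro summable_mult summable_geometric) simp
  have b_le: "norm (b n) \<le> l1norm (r_vec r t P FS \<nu> Z) * e n" for n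
  proof -
    have "norm (b n) \<le> l1norm (b n)" by (rule norm_le_l1norm)
    also have "\<dots> \<le> (\<Sum>j\<in>UNIV. e n * norm (r_vec r t P FS \<nu> Z $ j))"
      unfolding l1norm_def
    proof (rule sum_mono)
      fix j
      have "norm (b n $ j) = (1 - p) * norm (u n / (of_real (\<nu> j) - u n)) * norm (r_vec r t P FS \<nu> Z $ j)"
      proof -
        have "b n $ j = - (of_real (1 - p) * (u n / (of_real (\<nu> j) - u n)) * r_vec r t P FS \<nu> Z $ j)"
          unfolding b_def u_def[symmetric] Q_vec_nth[OF u_ne] by simp
        then show ?thesis
          unfolding norm_minus_cancel norm_mult norm_of_real using p_range
          by (simp only: norm_minus_cancel norm_mult norm_of_real abs_of_nonneg diff_ge_0_iff_ge)
      qed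
      also have "\<dots> \<le> 1 * e n * norm (r_vec r t P FS \<nu> Z $ j)"
        using p_range by (intro mult_right_mono mult_mono e) auto
      finally show "norm (b n $ j) \<le> e n * norm (r_vec r t P FS \<nu> Z $ j)" by simp
    qed
    finally show ?thesis by (simp add: l1norm_def sum_distrib_left mult.commute)
  qed
  have b_summable: "summable (\<lambda>n. norm (b n))"
    by (rule summable_comparison_test'[OF summable_mult[OF e_summable]]) (use b_le in auto)
  have Z_lim: "(\<lambda>n. \<chi> j. Z j (u n)) \<longlonglongrightarrow> of_real_vec \<pi>"
  proof (rule vec_tendstoI)
    fix i
    have "prob_space M'" "Winf \<in> borel_measurable M'" "Yinf \<in> M' \<rightarrow>\<^sub>M count_space UNIV" "AE \<omega> in M'. 0 \<le> Winf \<omega>"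
      using steady unfolding steady_state_def by blast+
    then have "(\<lambda>n. joint_transform M' Winf Yinf i (u n)) \<longlonglongrightarrow> of_real \<P>(\<omega> in M'. Yinf \<omega> = i)"
      by (intro joint_transform_tendsto u_re u_lim)
    moreover have "Z i (u n) = joint_transform M' Winf Yinf i (u n)" for n
      using steady u_re unfolding steady_state_def by blast
    moreover have "\<P>(\<omega> in M'. Yinf \<omega> = i) = \<pi> $ i"
      using steady unfolding steady_state_def by blast
    ultimately show "(\<lambda>n. (\<chi> j. Z j (u n)) $ i) \<longlonglongrightarrow> of_real_vec \<pi> $ i"
      by (simp add: of_real_vec_def)
  qed
  have rec: "(\<chi> j. Z j (u n)) = A n *v (\<chi> j. Z j (u (Suc n))) + b n" for n
    unfolding u_Suc A_def b_def u_def[symmetric] by (rule steady_state_recursion[OF steady u_re u_ne])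
  have A: "l1norm (A n *v v) \<le> (1 + e n) * l1norm v" for n v
    unfolding A_def u_def[symmetric] by (rule l1norm_H_mat_le[OF u_re u_ne e])
  note solution = linear_recursion_solution[where z="\<lambda>n. \<chi> j. Z j (u n)", OF rec A e_nonneg e_summable b_summable Z_lim]
  show "summable (\<lambda>n. matrix_prod A n *v b n)"
    "convergent (\<lambda>n. matrix_prod A (Suc n) *v of_real_vec \<pi>)"
    by (rule solution)+
  show "(\<chi> j. Z j s) = (\<Sum>n. matrix_prod A n *v b n) + lim (\<lambda>n. matrix_prod A (Suc n) *v of_real_vec \<pi>)"
    using solution(3) by (simp add: u_def)
qed

end

theorem mainTheorem10:
  fixes M :: "'a measure" and M' :: "'b measure"
    and r t p q :: real
    and P :: "real^'n^'n" and \<pi> :: "real^'n"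
    and FS Cp :: "'n \<Rightarrow> real measure" and \<nu> :: "'n \<Rightarrow> real"
    and Y :: "nat \<Rightarrow> 'a \<Rightarrow> 'n" and W S C :: "nat \<Rightarrow> 'a \<Rightarrow> real"
    and Winf :: "'b \<Rightarrow> real" and Yinf :: "'b \<Rightarrow> 'n"
    and Z :: "'n \<Rightarrow> complex \<Rightarrow> complex"
    and H :: "complex \<Rightarrow> complex^'n^'n" and Q :: "complex \<Rightarrow> complex^'n"
  assumes queue: "modulated_shot_noise_queue M r t p P \<pi> FS Cp \<nu> Y W S C"
    and steady: "steady_state M Y W \<pi> M' Winf Yinf Z"
    and q: "q = 1 - p"
    and H: "H = H_mat r t p P FS Cp \<nu>"
    and Q: "Q = Q_vec r t p P FS \<nu> Z"
  shows "(\<forall>j (s::complex). Re s \<ge> 0 \<and> s \<notin> range (\<lambda>k. complex_of_real (\<nu> k)) \<longrightarrow>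
           Z j s =
             (of_real p * lst (Cp j) s + of_real q * (of_real (\<nu> j) / (of_real (\<nu> j) - s)))
               * (\<Sum>i\<in>UNIV. of_real (P $ i $ j) * lst (FS i) (s * of_real (exp (- r * t)))
                     * Z i (s * of_real (exp (- r * t))))
             - s * of_real q / (of_real (\<nu> j) - s)
               * (\<Sum>i\<in>UNIV. of_real (P $ i $ j) * lst (FS i) (of_real (\<nu> j * exp (- r * t)))
                     * Z i (of_real (\<nu> j * exp (- r * t)))))
       \<and> (\<forall>s::complex. Re s \<ge> 0 \<and>
             (\<forall>n::nat. of_real (exp (- r * t * real n)) * s \<notin> range (\<lambda>k. complex_of_real (\<nu> k))) \<longrightarrow>
           summable (\<lambda>n. matrix_prod (\<lambda>d. H (of_real (exp (- r * t * real d)) * s)) n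
                           *v Q (of_real (exp (- r * t * real n)) * s)) \<and>
           convergent (\<lambda>n. matrix_prod (\<lambda>m. H (of_real (exp (- r * t * real m)) * s)) (Suc n)
                           *v of_real_vec \<pi>) \<and>
           (\<chi> j. Z j s) =
             (\<Sum>n. matrix_prod (\<lambda>d. H (of_real (exp (- r * t * real d)) * s)) n
                           *v Q (of_real (exp (- r * t * real n)) * s))
             + lim (\<lambda>n. matrix_prod (\<lambda>m. H (of_real (exp (- r * t * real m)) * s)) (Suc n)
                           *v of_real_vec \<pi>))"
proof (intro conjI allI impI)
  interpret modulated_shot_noise_queue M r t p P \<pi> FS Cp \<nu> Y W S C by (rule queue)
  fix j and s :: complex
  assume s: "Re s \<ge> 0 \<and> s \<notin> range (\<lambda>k. complex_of_real (\<nu> k))"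
  show "Z j s =
             (of_real p * lst (Cp j) s + of_real q * (of_real (\<nu> j) / (of_real (\<nu> j) - s)))
               * (\<Sum>i\<in>UNIV. of_real (P $ i $ j) * lst (FS i) (s * of_real (exp (- r * t)))
                     * Z i (s * of_real (exp (- r * t))))
             - s * of_real q / (of_real (\<nu> j) - s)
               * (\<Sum>i\<in>UNIV. of_real (P $ i $ j) * lst (FS i) (of_real (\<nu> j * exp (- r * t)))
                     * Z i (of_real (\<nu> j * exp (- r * t))))"
    unfolding q by (rule steady_state_equation[OF steady]) (use s in auto)
next
  interpret modulated_shot_noise_queue M r t p P \<pi> FS Cp \<nu> Y W S C by (rule queue)
  fix s :: complex
  assume s: "Re s \<ge> 0 \<and>
    (\<forall>n::nat. of_real (exp (- r * t * real n)) * s \<notin> range (\<lambda>k. complex_of_real (\<nu> k)))"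
  then have "0 \<le> Re s" "\<And>n j. of_real (exp (- r * t * real n)) * s \<noteq> of_real (\<nu> j)" by auto
  note series = steady_state_series[OF steady this, folded H Q]
  show "summable (\<lambda>n. matrix_prod (\<lambda>d. H (of_real (exp (- r * t * real d)) * s)) n
                           *v Q (of_real (exp (- r * t * real n)) * s))"
    and "convergent (\<lambda>n. matrix_prod (\<lambda>m. H (of_real (exp (- r * t * real m)) * s)) (Suc n)
                           *v of_real_vec \<pi>)"
    and "(\<chi> j. Z j s) =
             (\<Sum>n. matrix_prod (\<lambda>d. H (of_real (exp (- r * t * real d)) * s)) n
                           *v Q (of_real (exp (- r * t * real n)) * s))
             + lim (\<lambda>n. matrix_prod (\<lambda>m. H (of_real (exp (- r * t * real m)) * s)) (Suc n)
                           *v of_real_vec \<pi>)"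
    by (rule series)+
qed

end
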